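(* Let $E$ be an elliptic curve over $\mathbb{Q}_2$ with good ordinary reduction. Then $\mathbb{Q}_2(E[2])$ is $\mathbb{Q}_2$-isomorphic to one of the following fields: (i) $\mathbb{Q}_2$, (ii) the unramified quadratic extension $\mathbb{Q}_4$ of $\mathbb{Q}_2$, (iii) $L_1:=\mathbb{Q}_2[X]/(X^2+2X+2)$, (iv) $L_2:=\mathbb{Q}_2[X]/(X^2+2X+6)$. If $\mathbb{Q}_2(E[2])$ is (isomorphic to) one of $\mathbb{Q}_4, L_1, L_2$, then $\mathbb{Q}_2(P)=\mathbb{Q}_2$ for exactly two elements $P$ of $E[2]$ and $\mathbb{Q}_2(P)=\mathbb{Q}_2(E[2])$ for the other two elements $P$ of $E[2]$.
   Context: $E[2]$ is the group (of order 4, including the origin) of 2-torsion points of $E(\overline{\mathbb{Q}}_2)$; $\mathbb{Q}_2(P)$ (resp. $\mathbb{Q}_2(E[2])$) is the field generated over $\mathbb{Q}_2$ by the coordinates of $P$ (resp. of all points of $E[2]$), with $\mathbb{Q}_2(O)=\mathbb{Q}_2$ for the origin $O$. Good ordinary reduction means good reduction $\bar{E}$ with $\bar{E}(\overline{\mathbb{F}}_2)[2]\neq 0$. *)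

theory Defs
  imports
    "HOL-Algebra.Algebraic_Closure_Type" "HOL-Algebra.Generated_Fields" "HOL-Library.Z2"
begin

section \<open>The 2-adic integers and numbers\<close>

text \<open>The ring of 2-adic integers is the inverse limit of the rings of integers modulo \<open>2 ^ n\<close>: a compatible
  sequence lists, at position \<open>n\<close>, the representative in \<open>{0..<2 ^ n}\<close>.\<close>

definition compatible :: "(nat \<Rightarrow> int) \<Rightarrow> bool" where
  "compatible f \<longleftrightarrow> (\<forall>n. f n = f (Suc n) mod 2 ^ n)"

lemma compatibleD: "compatible f \<Longrightarrow> f n = f (Suc n) mod 2 ^ n"
  unfolding compatible_def by blast

lemma mod_power_Suc: "(k :: int) mod 2 ^ Suc n mod 2 ^ n = k mod 2 ^ n"
  by (rule mod_mod_cancel) (simp add: le_imp_power_dvd)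

lemma compatible_of_int: "compatible (\<lambda>n. k mod 2 ^ n)"
  unfolding compatible_def mod_power_Suc by blast

lemma compatible_add:
  assumes "compatible f" "compatible g"
  shows "compatible (\<lambda>n. (f n + g n) mod 2 ^ n)"
  unfolding compatible_def mod_power_Suc
proof
  fix n
  show "(f n + g n) mod 2 ^ n = (f (Suc n) + g (Suc n)) mod 2 ^ n"
    unfolding compatibleD[OF assms(1), of n] compatibleD[OF assms(2), of n] by (rule mod_add_eq)
qed

lemma compatible_diff:
  assumes "compatible f" "compatible g"
  shows "compatible (\<lambda>n. (f n - g n) mod 2 ^ n)"
  unfolding compatible_def mod_power_Suc
proof
  fix n
  show "(f n - g n) mod 2 ^ n = (f (Suc n) - g (Suc n)) mod 2 ^ n"
    unfolding compatibleD[OF assms(1), of n] compatibleD[OF assms(2), of n] by (rule mod_diff_eq)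
qed

lemma compatible_mult:
  assumes "compatible f" "compatible g"
  shows "compatible (\<lambda>n. (f n * g n) mod 2 ^ n)"
  unfolding compatible_def mod_power_Suc
proof
  fix n
  show "(f n * g n) mod 2 ^ n = (f (Suc n) * g (Suc n)) mod 2 ^ n"
    unfolding compatibleD[OF assms(1), of n] compatibleD[OF assms(2), of n] by (rule mod_mult_eq)
qed

lemma compatible_uminus:
  assumes "compatible f"
  shows "compatible (\<lambda>n. (- f n) mod 2 ^ n)"
  unfolding compatible_def mod_power_Suc
proof
  fix n
  show "(- f n) mod 2 ^ n = (- f (Suc n)) mod 2 ^ n"
    unfolding compatibleD[OF assms, of n] by (rule mod_minus_eq)
qed

typedef z2 = "{f. compatible f}"
  morphisms residue Abs_z2
  using compatible_of_int by blast

setup_lifting type_definition_z2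

lemma residue_Suc: "residue x n = residue x (Suc n) mod 2 ^ n"
  using residue[of x] compatibleD by blast

lemma residue_mod_same [simp]: "residue x n mod 2 ^ n = residue x n"
  by (subst (1 2) residue_Suc) (rule mod_mod_trivial)

lemma residue_mod: "m \<le> n \<Longrightarrow> residue x n mod 2 ^ m = residue x m"
proof (induction n rule: dec_induct)
  case base
  show ?case by simp
next
  case (step n)
  have "residue x (Suc n) mod 2 ^ m = residue x (Suc n) mod 2 ^ n mod 2 ^ m"
    using step.hyps by (simp add: mod_mod_cancel le_imp_power_dvd)
  then show ?case
    by (simp only: residue_Suc[symmetric] step.IH)
qed

lemma residue_0 [simp]: "residue x 0 = 0"
  using residue_mod_same[of x 0] by simp

lemma z2_eqI: "(\<And>n. residue x n = residue y n) \<Longrightarrow> x = y"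
  by (simp add: residue_inject[symmetric] fun_eq_iff)

instantiation z2 :: idom
begin

lift_definition zero_z2 :: z2 is "\<lambda>n. 0 mod 2 ^ n"
  by (rule compatible_of_int)

lift_definition one_z2 :: z2 is "\<lambda>n. 1 mod 2 ^ n"
  by (rule compatible_of_int)

lift_definition plus_z2 :: "z2 \<Rightarrow> z2 \<Rightarrow> z2" is "\<lambda>f g n. (f n + g n) mod 2 ^ n"
  by (rule compatible_add)

lift_definition minus_z2 :: "z2 \<Rightarrow> z2 \<Rightarrow> z2" is "\<lambda>f g n. (f n - g n) mod 2 ^ n"
  by (rule compatible_diff)

lift_definition uminus_z2 :: "z2 \<Rightarrow> z2" is "\<lambda>f n. (- f n) mod 2 ^ n"
  by (rule compatible_uminus)

lift_definition times_z2 :: "z2 \<Rightarrow> z2 \<Rightarrow> z2" is "\<lambda>f g n. (f n * g n) mod 2 ^ n"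
  by (rule compatible_mult)

lemmas residue_simps =
  zero_z2.rep_eq one_z2.rep_eq plus_z2.rep_eq minus_z2.rep_eq uminus_z2.rep_eq times_z2.rep_eq

lemma z2_no_zero_divisors:
  fixes x y :: z2
  assumes "x \<noteq> 0" "y \<noteq> 0"
  shows "x * y \<noteq> 0"
proof
  assume xy: "x * y = 0"
  obtain m where m: "residue x m \<noteq> 0"
    using assms(1) z2_eqI[of x 0] by (auto simp: residue_simps)
  obtain n where n: "residue y n \<noteq> 0"
    using assms(2) z2_eqI[of y 0] by (auto simp: residue_simps)
  have x: "\<not> 2 ^ m dvd residue x (m + n)"
    using m residue_mod[of m "m + n" x] by auto
  have y: "\<not> 2 ^ n dvd residue y (m + n)"
    using n residue_mod[of n "m + n" y] by auto
  have "residue (x * y) (m + n) = 0"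
    using xy by (simp add: residue_simps)
  then have dvd: "2 ^ (m + n) dvd residue x (m + n) * residue y (m + n)"
    by (simp add: residue_simps mod_eq_0_iff_dvd)
  have nz: "residue x (m + n) \<noteq> 0" "residue y (m + n) \<noteq> 0"
    using x y by auto
  have "m + n \<le> multiplicity 2 (residue x (m + n) * residue y (m + n))"
    using dvd nz by (simp add: power_dvd_iff_le_multiplicity)
  also have "\<dots> = multiplicity 2 (residue x (m + n)) + multiplicity 2 (residue y (m + n))"
    using nz by (simp add: prime_elem_multiplicity_mult_distrib)
  finally show False
    using x y nz by (simp add: power_dvd_iff_le_multiplicity)
qed

instance
proof
  fix x y z :: z2
  show "x * y * z = x * (y * z)"
    by (rule z2_eqI) (simp add: residue_simps mod_simps mult.assoc)
  show "x * y = y * x"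
    by (rule z2_eqI) (simp add: residue_simps mult.commute)
  show "1 * x = x"
    by (rule z2_eqI) (simp add: residue_simps mod_simps)
  show "x + y + z = x + (y + z)"
    by (rule z2_eqI) (simp add: residue_simps mod_simps add.assoc)
  show "x + y = y + x"
    by (rule z2_eqI) (simp add: residue_simps add.commute)
  show "0 + x = x"
    by (rule z2_eqI) (simp add: residue_simps)
  show "- x + x = 0"
    by (rule z2_eqI) (simp add: residue_simps mod_simps)
  show "x - y = x + - y"
    by (rule z2_eqI) (simp add: residue_simps mod_simps)
  show "(x + y) * z = x * z + y * z"
    by (rule z2_eqI) (simp add: residue_simps mod_simps distrib_right)
  show "x * (y + z) = x * y + x * z"
    by (rule z2_eqI) (simp add: residue_simps mod_simps distrib_left)
  show "0 * x = 0"
    by (rule z2_eqI) (simp add: residue_simps)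
  show "x * 0 = 0"
    by (rule z2_eqI) (simp add: residue_simps)
  show "(0::z2) \<noteq> 1"
  proof
    assume "(0::z2) = 1"
    then have "residue 0 1 = residue 1 1" by simp
    then show False by (simp add: residue_simps)
  qed
  show "x \<noteq> 0 \<Longrightarrow> y \<noteq> 0 \<Longrightarrow> x * y \<noteq> 0"
    by (rule z2_no_zero_divisors)
qed

end

type_synonym q2 = "z2 fract"

type_synonym q2_closure = "q2 alg_closure"

definition reduce :: "z2 \<Rightarrow> bit" where
  "reduce x = of_int (residue x 1)"

lemma of_int_mod_2_bit: "(of_int (k mod 2) :: bit) = of_int k"
  by (metis (full_types) bit_not_zero_iff even_of_int_iff even_zero mod2_eq_if odd_one)

lemma reduce_0 [simp]: "reduce 0 = 0"
  and reduce_1 [simp]: "reduce 1 = 1"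
  and reduce_add [simp]: "reduce (x + y) = reduce x + reduce y"
  and reduce_mult [simp]: "reduce (x * y) = reduce x * reduce y"
  by (simp_all add: reduce_def residue_simps of_int_mod_2_bit)

section \<open>Weierstrass curves\<close>

text \<open>\<open>Weierstrass a1 a2 a3 a4 a6\<close> is the projective curve
  \<open>y\<^sup>2 + a1 x y + a3 y = x\<^sup>3 + a2 x\<^sup>2 + a4 x + a6\<close>; the selector names carry the customary indices.\<close>

datatype 'a weierstrass =
  Weierstrass (a\<^sub>1: 'a) (a\<^sub>2: 'a) (a\<^sub>3: 'a) (a\<^sub>4: 'a) (a\<^sub>6: 'a)

definition discriminant :: "'a :: comm_ring_1 weierstrass \<Rightarrow> 'a" where
  "discriminant E =
    (let b2 = (a\<^sub>1 E)\<^sup>2 + 4 * a\<^sub>2 E;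
         b4 = 2 * a\<^sub>4 E + a\<^sub>1 E * a\<^sub>3 E;
         b6 = (a\<^sub>3 E)\<^sup>2 + 4 * a\<^sub>6 E;
         b8 = (a\<^sub>1 E)\<^sup>2 * a\<^sub>6 E + 4 * a\<^sub>2 E * a\<^sub>6 E - a\<^sub>1 E * a\<^sub>3 E * a\<^sub>4 E
              + a\<^sub>2 E * (a\<^sub>3 E)\<^sup>2 - (a\<^sub>4 E)\<^sup>2
     in - b2\<^sup>2 * b8 - 8 * b4 ^ 3 - 27 * b6\<^sup>2 + 9 * b2 * b4 * b6)"

definition elliptic_curve :: "'a :: field weierstrass \<Rightarrow> bool" where
  "elliptic_curve E \<longleftrightarrow> discriminant E \<noteq> 0"

text \<open>\<open>E'\<close> arises from \<open>E\<close> by the substitution \<open>x = u\<^sup>2 x' + r\<close>, \<open>y = u\<^sup>3 y' + u\<^sup>2 s x' + t\<close>; these are exactly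
  the isomorphisms between elliptic curves over the field \<open>'a\<close>.\<close>

definition isomorphic_curves :: "'a :: field weierstrass \<Rightarrow> 'a weierstrass \<Rightarrow> bool" where
  "isomorphic_curves E E' \<longleftrightarrow>
    (\<exists>u r s t. u \<noteq> 0 \<and>
       u * a\<^sub>1 E' = a\<^sub>1 E + 2 * s \<and>
       u\<^sup>2 * a\<^sub>2 E' = a\<^sub>2 E - s * a\<^sub>1 E + 3 * r - s\<^sup>2 \<and>
       u ^ 3 * a\<^sub>3 E' = a\<^sub>3 E + r * a\<^sub>1 E + 2 * t \<and>
       u ^ 4 * a\<^sub>4 E' = a\<^sub>4 E - s * a\<^sub>3 E + 2 * r * a\<^sub>2 E - (t + r * s) * a\<^sub>1 E + 3 * r\<^sup>2 - 2 * s * t \<and>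
       u ^ 6 * a\<^sub>6 E' = a\<^sub>6 E + r * a\<^sub>4 E + r\<^sup>2 * a\<^sub>2 E + r ^ 3 - t * a\<^sub>3 E - t\<^sup>2 - r * t * a\<^sub>1 E)"

datatype 'a point = Origin | Affine 'a 'a

fun on_curve :: "'a :: field weierstrass \<Rightarrow> 'a point \<Rightarrow> bool" where
  "on_curve E Origin \<longleftrightarrow> True"
| "on_curve E (Affine x y) \<longleftrightarrow>
     y\<^sup>2 + a\<^sub>1 E * x * y + a\<^sub>3 E * y = x ^ 3 + a\<^sub>2 E * x\<^sup>2 + a\<^sub>4 E * x + a\<^sub>6 E"

text \<open>The chord-tangent group law, in any characteristic: \<open>l\<close> is the slope of the chord
  (or tangent), which meets the curve in a third point with abscissa \<open>x3\<close>.\<close>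

fun point_add :: "'a :: field weierstrass \<Rightarrow> 'a point \<Rightarrow> 'a point \<Rightarrow> 'a point" where
  "point_add E Origin Q = Q"
| "point_add E P Origin = P"
| "point_add E (Affine x1 y1) (Affine x2 y2) =
    (if x1 = x2 \<and> y1 + y2 + a\<^sub>1 E * x2 + a\<^sub>3 E = 0 then Origin
     else
       let l = (if x1 = x2
                then (3 * x1\<^sup>2 + 2 * a\<^sub>2 E * x1 + a\<^sub>4 E - a\<^sub>1 E * y1) / (2 * y1 + a\<^sub>1 E * x1 + a\<^sub>3 E)
                else (y2 - y1) / (x2 - x1));
           x3 = l\<^sup>2 + a\<^sub>1 E * l - a\<^sub>2 E - x1 - x2
       in Affine x3 (- (l * (x3 - x1) + y1) - a\<^sub>1 E * x3 - a\<^sub>3 E))"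

definition two_torsion :: "'a :: field weierstrass \<Rightarrow> 'a alg_closure point set" where
  "two_torsion E =
    {P. on_curve (map_weierstrass to_ac E) P \<and> point_add (map_weierstrass to_ac E) P P = Origin}"

text \<open>Good reduction: some integral model over the 2-adic integers reduces to a nonsingular curve over the field with two elements
  (such a model is minimal, and its reduction is unique up to isomorphism).\<close>

definition good_model :: "q2 weierstrass \<Rightarrow> z2 weierstrass \<Rightarrow> bool" where
  "good_model E W \<longleftrightarrow>
    isomorphic_curves E (map_weierstrass to_fract W) \<and> elliptic_curve (map_weierstrass reduce W)"

definition good_ordinary_reduction :: "q2 weierstrass \<Rightarrow> bool" where
  "good_ordinary_reduction E \<longleftrightarrow>
    (\<exists>W. good_model E W \<and> two_torsion (map_weierstrass reduce W) \<noteq> {Origin})"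


section \<open>Extensions of the 2-adic numbers\<close>

abbreviation Q2_closure :: "q2_closure ring" where
  "Q2_closure \<equiv> ring_of_type_algebra"

abbreviation subring_of_closure :: "q2_closure set \<Rightarrow> q2_closure ring" where
  "subring_of_closure F \<equiv> Q2_closure\<lparr>carrier := F\<rparr>"

abbreviation Q2 :: "q2_closure set" where
  "Q2 \<equiv> range to_ac"

fun coordinates :: "'a point \<Rightarrow> 'a set" where
  "coordinates Origin = {}"
| "coordinates (Affine x y) = {x, y}"

definition Q2_adjoin :: "q2_closure point set \<Rightarrow> q2_closure set" where
  "Q2_adjoin S = generate_field Q2_closure (Q2 \<union> (\<Union>P\<in>S. coordinates P))"

definition two_division_field :: "q2 weierstrass \<Rightarrow> q2_closure set" where
  "two_division_field E = Q2_adjoin (two_torsion E)"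

text \<open>\<open>F\<close> and \<open>R\<close> are isomorphic as extensions of the 2-adic numbers, where \<open>\<iota>\<close> is the structure map of \<open>R\<close>.\<close>

definition Q2_isomorphic :: "q2_closure set \<Rightarrow> 'b ring \<Rightarrow> (q2 \<Rightarrow> 'b) \<Rightarrow> bool" where
  "Q2_isomorphic F R \<iota> \<longleftrightarrow>
    (\<exists>h \<in> ring_iso (subring_of_closure F) R. \<forall>c. h (to_ac c) = \<iota> c)"

definition quotient_ring :: "q2 poly \<Rightarrow> q2 poly set ring" where
  "quotient_ring f = ring_of_type_algebra Quot (PIdl\<^bsub>ring_of_type_algebra\<^esub> f)"

definition quotient_const :: "q2 poly \<Rightarrow> q2 \<Rightarrow> q2 poly set" where
  "quotient_const f c = (PIdl\<^bsub>ring_of_type_algebra\<^esub> f) +>\<^bsub>ring_of_type_algebra\<^esub> [:c:]"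

definition integers_of :: "q2_closure set \<Rightarrow> q2_closure set" where
  "integers_of F =
    {x \<in> F. \<exists>p :: z2 poly. Polynomial.lead_coeff p = 1 \<and> poly (map_poly (to_ac \<circ> to_fract) p) x = 0}"

text \<open>A finite extension is unramified if \<open>2\<close> is still a uniformizer, that is, generates the maximal ideal of
  the ring of integers; separability of the residue extension is automatic as residue fields are finite.\<close>

definition unramified_quadratic :: "q2_closure set \<Rightarrow> bool" where
  "unramified_quadratic F \<longleftrightarrow>
    subfield F Q2_closure \<and> Q2 \<subseteq> F \<and> ring.dimension Q2_closure 2 Q2 F \<and>
    maximalideal (PIdl\<^bsub>subring_of_closure (integers_of F)\<^esub> 2) (subring_of_closure (integers_of F))"

text \<open>The unramified quadratic extension is unique, so any one of them may serve as the target.\<close>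

definition isomorphic_to_Q4 :: "q2_closure set \<Rightarrow> bool" where
  "isomorphic_to_Q4 F \<longleftrightarrow>
    (\<exists>K. unramified_quadratic K \<and> Q2_isomorphic F (subring_of_closure K) to_ac)"

definition isomorphic_to_Q2 :: "q2_closure set \<Rightarrow> bool" where
  "isomorphic_to_Q2 F \<longleftrightarrow> Q2_isomorphic F ring_of_type_algebra (\<lambda>c. c)"

definition isomorphic_to_L1 :: "q2_closure set \<Rightarrow> bool" where
  "isomorphic_to_L1 F \<longleftrightarrow>
    Q2_isomorphic F (quotient_ring [:2, 2, 1:]) (quotient_const [:2, 2, 1:])"

definition isomorphic_to_L2 :: "q2_closure set \<Rightarrow> bool" where
  "isomorphic_to_L2 F \<longleftrightarrow>
    Q2_isomorphic F (quotient_ring [:6, 2, 1:]) (quotient_const [:6, 2, 1:])"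

end

theory Submission
  imports Defs
begin

text \<open>The abscissae of the points of order 2 are the roots of the cubic \<open>4 x\<^sup>3 + b2 x\<^sup>2 + 2 b4 x + b6\<close>, whose discriminant
  is 16 times that of the curve. For an integral model \<open>W\<close> with good ordinary reduction \<open>a1\<close> is odd, which forces
  a root of the cubic in the 2-adic numbers; the other two roots generate the field obtained by adjoining a square
  root of the discriminant of \<open>W\<close>, a 2-adic unit. Such a unit is a square times \<open>1\<close>, \<open>5\<close>, \<open>-1\<close> or \<open>-5\<close>, and these
  cases correspond to \<open>Q2\<close>, \<open>Q4\<close>, \<open>L1\<close> and \<open>L2\<close>.\<close>

section \<open>Arithmetic of the 2-adic numbers\<close>

text \<open>The discriminant enters because that of a product (x - e) q, with q quadratic, is the
  discriminant of q times the square of q(e). Up to squares the curve and q thus have the same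
  discriminant, and the other two roots are m + n t and m - n t with t^2 = c and m, n in
  \<open>Q2\<close>, n nonzero. All fields in play are then \<open>Q2\<close> or the explicit set
  \<open>adjoin_root t\<close>, and the final case distinction asks whether t lies in
  \<open>Q2\<close>. The match with L1 and L2 is X^2 + 2 X + 2 = (X + 1)^2 + 1 and X^2 + 2 X + 6 =
  (X + 1)^2 + 5. The costly case is c = 5: \<open>unramified_quadratic\<close> speaks of the ring of
  integers, so that ring has to be determined.\<close>

lemma residue_of_nat: "residue (of_nat n) k = int n mod 2 ^ k"
  by (induction n) (simp_all add: residue_simps mod_simps algebra_simps)

text \<open>Characteristic 0 passes to the fraction field, where the curve formulas divide by 2 and
  cancel factors such as 4 and 16.\<close>

instance z2 :: ring_char_0
proof
  show "inj (of_nat :: nat \<Rightarrow> z2)"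
  proof (rule injI)
    fix m n
    assume "(of_nat m :: z2) = of_nat n"
    \<comment> \<open>Position m + n is far enough out: its modulus exceeds both numbers, so neither
      is changed.\<close>
    then have "int m mod 2 ^ (m + n) = int n mod 2 ^ (m + n)"
      by (metis residue_of_nat)
    moreover have "m < 2 ^ (m + n)" "n < 2 ^ (m + n)"
      using less_exp[of m] less_exp[of n] power_increasing[of m "m + n" "2::nat"]
        power_increasing[of n "m + n" "2::nat"] by linarith+
    then have "int m < 2 ^ (m + n)" "int n < 2 ^ (m + n)"
      by (metis of_nat_less_iff of_nat_numeral of_nat_power)+
    ultimately show "m = n"
      by simp
  qed
qed

lemma to_fract_of_nat [simp]: "to_fract (of_nat n) = of_nat n"
  by (induction n) simp_all

instance fract :: ("{idom, ring_char_0}") field_char_0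
proof
  show "inj (of_nat :: nat \<Rightarrow> 'a fract)"
    by (rule injI) (metis of_nat_eq_iff to_fract_eq_iff to_fract_of_nat)
qed

lemma to_fract_numeral [simp]: "to_fract (numeral n) = numeral n"
  by (metis of_nat_numeral to_fract_of_nat)

lemma to_fract_power [simp]: "to_fract (x ^ n) = to_fract x ^ n"
  by (induction n) simp_all

lemma z2_of_compatible:
  assumes "compatible f"
  obtains x where "residue x = f"
  using Abs_z2_inverse[of f] assms that by blast

text \<open>Doubling gains one binary digit; this shift of the position makes the map of
  \<open>z2_fixed_point\<close> a contraction.\<close>

lemma residue_double: "residue (2 * z) (Suc n) = 2 * residue z n"
proof -
  have "residue (2 * z) (Suc n) = (2 * residue z (Suc n)) mod (2 * 2 ^ n)"
    unfolding mult_2 plus_z2.rep_eq by simp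
  then show ?thesis
    by (simp add: residue_Suc[of z n])
qed

text \<open>The map \<open>x \<mapsto> a + 2 * h x\<close> is a contraction, which makes this the only form of Hensel's lemma needed below.\<close>

lemma z2_fixed_point:
  fixes h :: "z2 \<Rightarrow> z2"
  assumes h: "\<And>x y n. residue x n = residue y n \<Longrightarrow> residue (h x) n = residue (h y) n"
  obtains x where "x = a + 2 * h x"
proof -
  define g where "g x = a + 2 * h x" for x
  define it where "it n = (g ^^ n) (0 :: z2)" for n
  have g: "residue (g x) (Suc n) = residue (g y) (Suc n)" if "residue x n = residue y n" for x y n
    using h[OF that] by (simp add: g_def plus_z2.rep_eq residue_double)
  have it_Suc: "it (Suc n) = g (it n)" for n
    by (simp add: it_def)
  have step: "residue (it (Suc n)) n = residue (it n) n" for n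
  proof (induction n)
    case (Suc n)
    then show ?case
      unfolding it_Suc[of n] it_Suc[of "Suc n"] by (rule g)
  qed simp
  \<comment> \<open>The limit is the diagonal: by \<open>step\<close>, passing from iterate n to the
    next leaves position n unchanged.\<close>
  have "compatible (\<lambda>n. residue (it n) n)"
    unfolding compatible_def
  proof
    fix n
    show "residue (it n) n = residue (it (Suc n)) (Suc n) mod 2 ^ n"
      using step[of n] residue_Suc[of "it (Suc n)" n] by (rule trans[OF sym])
  qed
  then obtain x where "residue x = (\<lambda>n. residue (it n) n)"
    by (rule z2_of_compatible)
  then have x: "residue x n = residue (it n) n" for n
    by simp
  have "residue x n = residue (g x) n" for n
    by (cases n) (simp_all only: residue_0 x it_Suc g[OF x[symmetric]])
  then show ?thesis
    using that[of x] z2_eqI[of x "g x"] by (simp add: g_def)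
qed

section \<open>Parity, units and powers of 2 in the 2-adic integers\<close>

lemma reduce_diff [simp]: "reduce (x - y) = reduce x - reduce y"
  by (metis add_diff_cancel diff_add_cancel reduce_add)

lemma reduce_minus [simp]: "reduce (- x) = - reduce x"
  using reduce_diff[of 0 x] by simp

lemma reduce_power [simp]: "reduce (x ^ n) = reduce x ^ n"
  by (induction n) simp_all

lemma reduce_of_nat [simp]: "reduce (of_nat n) = of_nat n"
  by (induction n) simp_all

lemma reduce_numeral [simp]: "reduce (numeral n) = numeral n"
  by (metis of_nat_numeral reduce_of_nat)

lemma reduce_eq_0_iff: "reduce z = 0 \<longleftrightarrow> (\<exists>m. z = 2 * m)"
proof
  assume "reduce z = 0"
  then have even: "even (residue z 1)"
    unfolding reduce_def by (metis even_of_int_iff even_zero)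
  have dvd: "2 dvd residue z (Suc n)" for n
  proof -
    have "residue z (Suc n) mod 2 ^ 1 = residue z 1"
      by (rule residue_mod) simp
    then have "residue z (Suc n) mod 2 = residue z 1"
      by simp
    then show ?thesis
      using even by presburger
  qed
  \<comment> \<open>Halving uses up one digit, so the quotient at position n is read off from z at
    position n + 1.\<close>
  have "residue z (Suc n) div 2 = residue z (Suc (Suc n)) div 2 mod 2 ^ n" for n
    using residue_Suc[of z "Suc n"] by (simp add: zmod_zmult2_eq)
  then have "compatible (\<lambda>n. residue z (Suc n) div 2)"
    unfolding compatible_def by blast
  then obtain m where m: "residue m = (\<lambda>n. residue z (Suc n) div 2)"
    by (rule z2_of_compatible)
  have "residue z n = residue (2 * m) n" for n
    by (cases n) (simp_all add: residue_double m dvd)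
  then show "\<exists>m. z = 2 * m"
    using z2_eqI by blast
next
  assume "\<exists>m. z = 2 * m"
  then show "reduce z = 0"
    by auto
qed

lemma reduce_eq_1_iff: "reduce z = 1 \<longleftrightarrow> (\<exists>m. z = 1 + 2 * m)"
proof -
  have "reduce z = 1 \<longleftrightarrow> reduce (z - 1) = 0"
    by auto
  also have "\<dots> \<longleftrightarrow> (\<exists>m. z = 1 + 2 * m)"
    unfolding reduce_eq_0_iff by (simp add: algebra_simps)
  finally show ?thesis .
qed

lemma z2_parity_cases:
  fixes z :: z2
  obtains m where "z = 2 * m" | m where "z = 1 + 2 * m"
  using reduce_eq_0_iff[of z] reduce_eq_1_iff[of z] by (cases "reduce z") auto

text \<open>The inverse of 1 + 2 m solves x = 1 - 2 m x, a fixed-point equation.\<close>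

lemma z2_unit:
  fixes z :: z2
  assumes "reduce z = 1"
  obtains w where "z * w = 1"
proof -
  obtain m where m: "z = 1 + 2 * m"
    using assms reduce_eq_1_iff by blast
  obtain x where "x = 1 + 2 * (- m * x)"
    by (rule z2_fixed_point[of "\<lambda>x. - m * x" 1]) (simp add: residue_simps)
  then have "z * x = 1"
    by (simp add: m algebra_simps)
  then show ?thesis
    by (rule that)
qed

text \<open>Induction on a position with nonzero residue: halving an even z moves it down by one, so
  the halvings come to an end.\<close>

lemma z2_decompose:
  fixes z :: z2
  assumes "z \<noteq> 0"
  obtains k u where "reduce u = 1" "z = 2 ^ k * u"
proof -
  obtain n where "residue z n \<noteq> 0"
    using assms z2_eqI[of z 0] by (auto simp: residue_simps)
  then have "\<exists>k u. reduce u = 1 \<and> z = 2 ^ k * u"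
  proof (induction n arbitrary: z)
    case 0
    then show ?case by simp
  next
    case (Suc n)
    show ?case
    proof (cases z rule: z2_parity_cases)
      case (1 m)
      then have "residue m n \<noteq> 0"
        using Suc.prems by (simp add: residue_double)
      then obtain k u where "reduce u = 1" "m = 2 ^ k * u"
        using Suc.IH by blast
      then have "reduce u = 1 \<and> z = 2 ^ Suc k * u"
        using 1 by simp
      then show ?thesis by blast
    next
      case (2 m)
      then have "reduce z = 1 \<and> z = 2 ^ 0 * z"
        by simp
      then show ?thesis by blast
    qed
  qed
  then show ?thesis
    using that by blast
qed

section \<open>Denominators and square classes\<close>

text \<open>The odd part of a denominator is a unit, which leaves a power of 2.\<close>

lemma q2_denominator:
  fixes q :: q2
  obtains k z where "2 ^ k * q = to_fract z"
proof (cases q)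
  case (Fract a b)
  obtain k u where u: "reduce u = 1" "b = 2 ^ k * u"
    using Fract z2_decompose by blast
  obtain w where w: "u * w = 1"
    using u(1) z2_unit by blast
  have "to_fract u * to_fract w = 1"
    using w by (simp flip: to_fract_mult)
  moreover have "to_fract u \<noteq> 0"
    using u by auto
  moreover have "q = to_fract a / (2 ^ k * to_fract u)"
    using Fract u by (simp add: Fract_conv_to_fract)
  ultimately have "2 ^ k * q = to_fract a * (to_fract u * to_fract w) / to_fract u"
    by simp
  then have "2 ^ k * q = to_fract (a * w)"
    using \<open>to_fract u \<noteq> 0\<close> by simp
  then show ?thesis
    by (rule that)
qed

lemma square_of_odd:
  assumes "reduce z = 1"
  obtains n where "z\<^sup>2 = 1 + 8 * n"
proof -
  obtain m where m: "z = 1 + 2 * m"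
    using assms reduce_eq_1_iff by blast
  have "reduce (m * (m + 1)) = 0"
    by (cases "reduce m") simp_all
  then obtain n where "m * (m + 1) = 2 * n"
    using reduce_eq_0_iff by blast
  then have "4 * (m * (m + 1)) = 4 * (2 * n)"
    by simp
  then have "z\<^sup>2 = 1 + 8 * n"
    unfolding m by (simp add: power2_eq_square algebra_simps)
  then show ?thesis
    by (rule that)
qed

text \<open>The class modulo 8 decides: c is the listed number congruent to d modulo 8, so that d c
  is 1 modulo 8 and hence a square. Multiplying by c instead of dividing keeps the claim inside the
  ring.\<close>

lemma odd_square_class:
  assumes "reduce d = 1"
  obtains c w where "c \<in> {1, 5, -1, -5}" "d * c = w\<^sup>2"
proof -
  \<comment> \<open>The equation 1 + 8 m = (1 + 4 x)^2 amounts to x = m - 2 x^2, again a fixed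
    point.\<close>
  have sq: "\<exists>w. 1 + 8 * m = w\<^sup>2" for m :: z2
  proof -
    obtain x where x: "x = m + 2 * - x\<^sup>2"
      by (rule z2_fixed_point[of "\<lambda>x. - x\<^sup>2" m]) (simp add: power2_eq_square residue_simps)
    have "1 + 8 * (x + 2 * x\<^sup>2) = (1 + 4 * x)\<^sup>2"
      by (simp add: power2_eq_square algebra_simps)
    moreover have "x + 2 * x\<^sup>2 = m"
      by (subst (1) x) simp
    ultimately show ?thesis by metis
  qed
  obtain m where m: "d = 1 + 2 * m"
    using assms reduce_eq_1_iff by blast
  show ?thesis
  proof (cases m rule: z2_parity_cases)
    case m1: (1 n)
    show ?thesis
    proof (cases n rule: z2_parity_cases)
      case (1 l)
      then have "d * 1 = 1 + 8 * l" using m m1 by simp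
      then show ?thesis using sq[of l] that[of 1] by auto
    next
      case (2 l)
      then have "d * 5 = 1 + 8 * (3 + 5 * l)" using m m1 by simp
      then show ?thesis using sq[of "3 + 5 * l"] that[of 5] by auto
    qed
  next
    case m1: (2 n)
    show ?thesis
    proof (cases n rule: z2_parity_cases)
      case (1 l)
      then have "d * -5 = 1 + 8 * (- 2 - 5 * l)" using m m1 by simp
      then show ?thesis using sq[of "- 2 - 5 * l"] that[of "-5"] by auto
    next
      case (2 l)
      then have "d * -1 = 1 + 8 * (- 1 - l)" using m m1 by simp
      then show ?thesis using sq[of "- 1 - l"] that[of "-1"] by auto
    qed
  qed
qed

text \<open>Descent on the denominator: let 2^k q = z with k least. For k > 0 the square z^2 = 4^k c
  is even, hence so is z, and cancelling a factor 2 contradicts minimality.\<close>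

lemma q2_square_root_integral:
  assumes "q\<^sup>2 = to_fract c" "reduce c = 1"
  obtains z where "q = to_fract z" "reduce z = 1"
proof -
  define P where "P k \<longleftrightarrow> (\<exists>z. 2 ^ k * q = to_fract z)" for k
  have "\<exists>k. P k"
    using q2_denominator[of q] unfolding P_def by metis
  then have "P (LEAST k. P k)"
    by (rule LeastI_ex)
  moreover define k where "k = (LEAST k. P k)"
  ultimately obtain z where z: "2 ^ k * q = to_fract z"
    unfolding P_def by blast
  have "to_fract (z\<^sup>2) = to_fract (4 ^ k * c)"
    unfolding to_fract_power z[symmetric] power_mult_distrib assms(1)
    by (simp add: power2_eq_square flip: power_mult_distrib)
  then have zc: "z\<^sup>2 = 4 ^ k * c"
    by (simp only: to_fract_eq_iff)
  show ?thesis
  proof (cases k)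
    case 0
    with z zc have "q = to_fract z" "reduce (z\<^sup>2) = 1"
      using assms(2) by simp_all
    moreover from this(2) have "reduce z = 1"
      by (cases "reduce z") simp_all
    ultimately show ?thesis using that by blast
  next
    case (Suc l)
    have "reduce (z\<^sup>2) = 0"
      unfolding zc Suc by simp
    then have "reduce z = 0"
      by simp
    then obtain m where "z = 2 * m"
      using reduce_eq_0_iff by blast
    then have "2 ^ l * q = to_fract m"
      using z Suc by simp
    then have "P l"
      unfolding P_def by blast
    then have "k \<le> l"
      unfolding k_def by (rule Least_le)
    then show ?thesis using Suc by simp
  qed
qed

text \<open>An odd square is 1 modulo 8, and 5, -1, -5 are not.\<close>

lemma q2_not_square:
  assumes "c \<in> {5, -1, -5}"
  shows "(q :: q2)\<^sup>2 \<noteq> to_fract c"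
proof
  assume q: "q\<^sup>2 = to_fract c"
  have "reduce c = 1"
    using assms by auto
  then obtain z where z: "q = to_fract z" "reduce z = 1"
    using q q2_square_root_integral by blast
  obtain n where "z\<^sup>2 = 1 + 8 * n"
    using z(2) square_of_odd by blast
  moreover have "z\<^sup>2 = c"
    using q z(1) by (simp flip: to_fract_power)
  ultimately have c: "c = 1 + 2 * (4 * n)"
    by simp
  \<comment> \<open>As \<open>reduce\<close> sees only parity, 8 n = c - 1 is first divided by the
    power of 2 in c - 1: by 4 for c = 5, by 2 for the other two.\<close>
  have "2 * n = 1 \<or> 4 * n = -1 \<or> 4 * n = -3"
  proof -
    have n: "2 * (4 * n) = c - 1"
      using c by simp
    consider "c = 5" | "c = -1" | "c = -5"
      using assms by blast
    then show ?thesis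
    proof cases
      case 1
      with n have "4 * (2 * n) = 4 * 1" by simp
      then show ?thesis unfolding mult_cancel_left by simp
    next
      case 2
      with n have "2 * (4 * n) = 2 * -1" by simp
      then show ?thesis unfolding mult_cancel_left by simp
    next
      case 3
      with n have "2 * (4 * n) = 2 * -3" by simp
      then show ?thesis unfolding mult_cancel_left by simp
    qed
  qed
  then have "reduce (2 * n) = reduce 1 \<or> reduce (4 * n) = reduce (-1) \<or> reduce (4 * n) = reduce (-3)"
    by metis
  then show False
    by simp
qed

section \<open>Quadratic extensions of the 2-adic numbers\<close>

lemma ring_of_type_algebra_simps [simp]:
  fixes x y :: "'a :: ring_1"
  shows "carrier (ring_of_type_algebra :: 'a ring) = UNIV"
    and "x \<otimes>\<^bsub>ring_of_type_algebra\<^esub> y = x * y"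
    and "x \<oplus>\<^bsub>ring_of_type_algebra\<^esub> y = x + y"
    and "\<one>\<^bsub>ring_of_type_algebra\<^esub> = (1 :: 'a)"
    and "\<zero>\<^bsub>ring_of_type_algebra\<^esub> = (0 :: 'a)"
  by (simp_all add: ring_of_type_algebra_def)

lemma ring_of_type_algebra_a_inv [simp]:
  fixes x :: "'a :: comm_ring_1"
  shows "\<ominus>\<^bsub>ring_of_type_algebra\<^esub> x = - x"
proof -
  interpret ring "ring_of_type_algebra :: 'a ring" ..
  show ?thesis
    by (rule minus_equality) simp_all
qed

lemma ring_of_type_algebra_m_inv [simp]:
  fixes x :: "'a :: Fields.field"
  assumes "x \<noteq> 0"
  shows "inv\<^bsub>ring_of_type_algebra\<^esub> x = inverse x"
proof -
  interpret field "ring_of_type_algebra :: 'a ring" ..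
  show ?thesis
    by (rule comm_inv_char) (use assms in simp_all)
qed

section \<open>Adjoining a square root\<close>

text \<open>Explicit linear expressions instead of a generated field, so that elements come with
  coordinates. The set is meant for t^2 in \<open>Q2\<close>; if t itself lies in \<open>Q2\<close>,
  it is just \<open>Q2\<close>.\<close>

definition adjoin_root :: "q2_closure \<Rightarrow> q2_closure set" where
  "adjoin_root t = range (\<lambda>(a, b). to_ac a + to_ac b * t)"

lemma adjoin_rootI: "x = to_ac a + to_ac b * t \<Longrightarrow> x \<in> adjoin_root t"
  unfolding adjoin_root_def by auto

lemma adjoin_rootE:
  assumes "x \<in> adjoin_root t"
  obtains a b where "x = to_ac a + to_ac b * t"
  using assms unfolding adjoin_root_def by auto

lemma Q2_subset_adjoin_root: "Q2 \<subseteq> adjoin_root t"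
  using adjoin_rootI[of _ _ 0] by auto

lemma adjoin_root_self: "t \<in> adjoin_root t"
  using adjoin_rootI[of _ 0 1] by simp

lemma subfield_adjoin_root:
  assumes t: "t\<^sup>2 = to_ac d"
  shows "subfield (adjoin_root t) Q2_closure"
proof -
  interpret field Q2_closure ..
  show ?thesis
  proof (rule subfieldI', rule subringI)
    show "\<one>\<^bsub>Q2_closure\<^esub> \<in> adjoin_root t"
      using adjoin_rootI[of _ 1 0] by simp
  next
    fix x assume "x \<in> adjoin_root t"
    then obtain a b where "x = to_ac a + to_ac b * t" by (rule adjoin_rootE)
    then show "\<ominus>\<^bsub>Q2_closure\<^esub> x \<in> adjoin_root t"
      by (intro adjoin_rootI[of _ "- a" "- b"]) simp
  next
    fix x y assume "x \<in> adjoin_root t" "y \<in> adjoin_root t"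
    then obtain a b c e where xy: "x = to_ac a + to_ac b * t" "y = to_ac c + to_ac e * t"
      by (metis adjoin_rootE)
    then show "x \<oplus>\<^bsub>Q2_closure\<^esub> y \<in> adjoin_root t"
      by (intro adjoin_rootI[of _ "a + c" "b + e"]) (simp add: algebra_simps)
    have "x * y = to_ac a * to_ac c + to_ac b * to_ac e * t\<^sup>2 + (to_ac a * to_ac e + to_ac b * to_ac c) * t"
      unfolding xy by (simp add: power2_eq_square algebra_simps)
    then show "x \<otimes>\<^bsub>Q2_closure\<^esub> y \<in> adjoin_root t"
      unfolding t by (intro adjoin_rootI[of _ "a * c + b * e * d" "a * e + b * c"]) simp
  next
    fix x assume "x \<in> adjoin_root t - {\<zero>\<^bsub>Q2_closure\<^esub>}"
    then have x: "x \<in> adjoin_root t" "x \<noteq> 0" by auto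
    then obtain a b where ab: "x = to_ac a + to_ac b * t" by (metis adjoin_rootE)
    \<comment> \<open>The inverse is the conjugate a - b t over the norm, unless the conjugate
      vanishes, that is, x = 2 a. This can happen if t is in \<open>Q2\<close>; then x is inverted
      directly as a constant.\<close>
    have "inverse x \<in> adjoin_root t"
    proof (cases "x = to_ac (2 * a)")
      case True
      then show ?thesis by (intro adjoin_rootI[of _ "inverse (2 * a)" 0]) simp
    next
      case False
      define y where "y = to_ac a - to_ac b * t"
      define n where "n = a\<^sup>2 - b\<^sup>2 * d"
      have "x * y = to_ac a ^ 2 - to_ac b ^ 2 * t\<^sup>2"
        unfolding ab y_def by (simp add: power2_eq_square algebra_simps)
      then have xy: "x * y = to_ac n"
        unfolding t n_def by simp
      have "y \<noteq> 0"
        using False unfolding ab y_def by auto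
      with x xy have "to_ac n \<noteq> 0" by (metis no_zero_divisors)
      then have "inverse x = y / to_ac n"
        using x xy by (simp add: field_simps)
      then show ?thesis
        by (intro adjoin_rootI[of _ "a / n" "- b / n"]) (simp add: y_def diff_divide_distrib)
    qed
    then show "inv\<^bsub>Q2_closure\<^esub> x \<in> adjoin_root t"
      using x by simp
  qed simp
qed

lemma subfield_Q2: "subfield Q2 Q2_closure"
proof -
  have "adjoin_root 0 = Q2"
    unfolding adjoin_root_def by auto
  then show ?thesis
    using subfield_adjoin_root[of 0 0] by simp
qed

lemma Q2_closure_subfieldD:
  assumes "subfield K Q2_closure"
  shows "x \<in> K \<Longrightarrow> y \<in> K \<Longrightarrow> x + y \<in> K"
    and "x \<in> K \<Longrightarrow> y \<in> K \<Longrightarrow> x * y \<in> K"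
  using subringE(6,7)[OF subfieldE(1)[OF assms]] by simp_all

lemma adjoin_root_subset:
  assumes "subfield K Q2_closure" "Q2 \<subseteq> K" "t \<in> K"
  shows "adjoin_root t \<subseteq> K"
proof
  fix x assume "x \<in> adjoin_root t"
  then obtain a b where x: "x = to_ac a + to_ac b * t" by (rule adjoin_rootE)
  have "to_ac a \<in> K" "to_ac b \<in> K" using assms by auto
  then show "x \<in> K" unfolding x using assms Q2_closure_subfieldD by metis
qed

lemma adjoin_root_affine:
  assumes "t\<^sup>2 = to_ac d" "b \<noteq> 0" "subfield K Q2_closure" "Q2 \<subseteq> K" "to_ac a + to_ac b * t \<in> K"
  shows "adjoin_root t \<subseteq> K"
proof (rule adjoin_root_subset[OF assms(3,4)])
  have Q2: "to_ac c \<in> K" for c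
    using assms(4) by blast
  have "to_ac (- a / b) + to_ac (1 / b) * (to_ac a + to_ac b * t) \<in> K"
    by (rule Q2_closure_subfieldD(1)[OF assms(3) Q2 Q2_closure_subfieldD(2)[OF assms(3) Q2 assms(5)]])
  also have "to_ac (- a / b) + to_ac (1 / b) * (to_ac a + to_ac b * t) = t"
    using assms(2) by (simp add: distrib_left)
  finally show "t \<in> K" .
qed

lemma adjoin_root_coordinates_unique:
  assumes "t \<notin> Q2" "to_ac a + to_ac b * t = to_ac a' + to_ac b' * t"
  shows "a = a' \<and> b = b'"
proof -
  have eq: "to_ac (b - b') * t = to_ac (a' - a)"
    using assms(2) by (simp add: algebra_simps)
  have "b = b'"
  proof (rule ccontr)
    assume "b \<noteq> b'"
    then have "t = to_ac ((a' - a) / (b - b'))"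
      using eq by (simp add: field_simps del: to_ac_diff)
    then show False using assms(1) by blast
  qed
  with eq show ?thesis by simp
qed

lemma Q2_adjoin_eqI:
  assumes "subfield K Q2_closure" "Q2 \<union> (\<Union>P\<in>S. coordinates P) \<subseteq> K"
    and "\<And>L. subfield L Q2_closure \<Longrightarrow> Q2 \<union> (\<Union>P\<in>S. coordinates P) \<subseteq> L \<Longrightarrow> K \<subseteq> L"
  shows "Q2_adjoin S = K"
proof -
  interpret field Q2_closure ..
  show ?thesis
    unfolding Q2_adjoin_def by (rule generate_fieldI[symmetric]) (use assms in simp_all)
qed

section \<open>Isomorphisms over the 2-adic numbers\<close>

text \<open>Surjectivity leaves no room for non-constants in R, which tells \<open>Q2\<close> from
  its proper extensions.\<close>

lemma Q2_isomorphic_Q2_const: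
  assumes "Q2_isomorphic Q2 R \<iota>" "x \<in> carrier R"
  obtains c where "x = \<iota> c"
proof -
  obtain h where h: "h \<in> ring_iso (subring_of_closure Q2) R" "\<And>c. h (to_ac c) = \<iota> c"
    using assms(1) unfolding Q2_isomorphic_def by blast
  have "h ` Q2 = carrier R"
    using h(1) unfolding ring_iso_def bij_betw_def by simp
  then have "x \<in> h ` Q2"
    using assms(2) by simp
  then show ?thesis
    using h(2) that by fastforce
qed

lemma isomorphic_to_Q2_Q2: "isomorphic_to_Q2 Q2"
proof -
  have "of_ac (to_ac a + to_ac b) = a + b" "of_ac (to_ac a * to_ac b) = a * b" for a b :: q2
    by (simp_all add: of_ac_eqI)
  then have "of_ac \<in> ring_hom (subring_of_closure Q2) (ring_of_type_algebra :: q2 ring)"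
    by (intro ring_hom_memI) (simp_all, (elim imageE, simp)+)
  moreover have "bij_betw of_ac Q2 UNIV"
    by (simp add: bij_betw_def inj_on_def image_image)
  ultimately have "of_ac \<in> ring_iso (subring_of_closure Q2) (ring_of_type_algebra :: q2 ring)"
    unfolding ring_iso_def by simp
  then show ?thesis
    unfolding isomorphic_to_Q2_def Q2_isomorphic_def by (intro bexI[of _ of_ac]) simp_all
qed

text \<open>The constants would fill K, whose dimension would then be both 1 and 2.\<close>

lemma not_isomorphic_to_Q4_Q2: "\<not> isomorphic_to_Q4 Q2"
proof
  interpret ring Q2_closure ..
  assume "isomorphic_to_Q4 Q2"
  then obtain K where K: "unramified_quadratic K" "Q2_isomorphic Q2 (subring_of_closure K) to_ac"
    unfolding isomorphic_to_Q4_def by blast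
  have "K \<subseteq> Q2"
  proof
    fix x assume "x \<in> K"
    then have "x \<in> carrier (subring_of_closure K)" by simp
    then show "x \<in> Q2" using Q2_isomorphic_Q2_const[OF K(2)] by blast
  qed
  then have "dimension 2 Q2 Q2"
    using K(1) unfolding unramified_quadratic_def by (metis subset_antisym)
  then have "(2 :: nat) = 1"
    using subfield_Q2 dimension_one dimension_is_inj by blast
  then show False by simp
qed

lemma PIdl_poly: "PIdl\<^bsub>ring_of_type_algebra\<^esub> (f :: q2 poly) = {p. f dvd p}"
  unfolding cgenideal_def by (auto simp: dvd_def mult.commute)

lemma coset_poly: "(PIdl\<^bsub>ring_of_type_algebra\<^esub> (f :: q2 poly)) +>\<^bsub>ring_of_type_algebra\<^esub> p = {q. f dvd q - p}"
proof -
  have "f dvd q - p \<longleftrightarrow> (\<exists>r. f dvd r \<and> q = r + p)" for q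
    by (metis diff_add_cancel add_diff_cancel_right')
  then show ?thesis
    unfolding PIdl_poly a_r_coset_def' by auto
qed

text \<open>The class of X would be that of a constant c, so f would divide X - c, which has degree
  1.\<close>

lemma not_Q2_isomorphic_quotient_ring:
  assumes "Polynomial.degree f > 1"
  shows "\<not> Q2_isomorphic Q2 (quotient_ring f) (quotient_const f)"
proof
  assume iso: "Q2_isomorphic Q2 (quotient_ring f) (quotient_const f)"
  have "(PIdl\<^bsub>ring_of_type_algebra\<^esub> f) +>\<^bsub>ring_of_type_algebra\<^esub> [:0, 1:] \<in> carrier (quotient_ring f)"
    unfolding quotient_ring_def FactRing_def A_RCOSETS_def' by auto
  then obtain c where "(PIdl\<^bsub>ring_of_type_algebra\<^esub> f) +>\<^bsub>ring_of_type_algebra\<^esub> [:0, 1:] = quotient_const f c"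
    using Q2_isomorphic_Q2_const[OF iso] by blast
  then have "{q. f dvd q - [:0, 1:]} = {q. f dvd q - [:c:]}"
    unfolding quotient_const_def coset_poly .
  then have "f dvd [:0, 1:] - [:c:]"
    by (metis (mono_tags) diff_self dvd_0_right mem_Collect_eq)
  then have "f dvd [:- c, 1:]" by simp
  then show False
    using assms by (auto dest!: dvd_imp_degree_le)
qed

text \<open>The polynomial is \<open>(X + 1)\<^sup>2 - d\<close>, hence the evaluation at \<open>t - 1\<close>.\<close>

lemma Q2_isomorphic_quotient_ring:
  assumes t: "t\<^sup>2 = to_ac d" "t \<notin> Q2"
  shows "Q2_isomorphic (adjoin_root t) (quotient_ring [:1 - d, 2, 1:]) (quotient_const [:1 - d, 2, 1:])"
proof -
  define f where "f = [:1 - d, 2, 1:]"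
  define \<phi> where "\<phi> p = poly (map_poly to_ac p) (t - 1)" for p :: "q2 poly"
  have \<phi>_add: "\<phi> (p + q) = \<phi> p + \<phi> q" for p q
  proof -
    have "map_poly to_ac (p + q) = map_poly to_ac p + map_poly to_ac q"
      by (rule poly_eqI) (simp add: coeff_map_poly)
    then show ?thesis
      unfolding \<phi>_def by simp
  qed
  have \<phi>_pCons: "\<phi> (pCons a p) = to_ac a + (t - 1) * \<phi> p" for a p
    unfolding \<phi>_def by (simp add: map_poly_pCons)
  have \<phi>_smult: "\<phi> (smult a p) = to_ac a * \<phi> p" for a p
    unfolding \<phi>_def by (simp add: map_poly_smult)
  have \<phi>_0: "\<phi> 0 = 0"
    unfolding \<phi>_def by simp
  have \<phi>_mult: "\<phi> (p * q) = \<phi> p * \<phi> q" for p q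
    by (induction p) (simp_all add: \<phi>_0 \<phi>_add \<phi>_pCons \<phi>_smult algebra_simps)
  have \<phi>_f: "\<phi> f = 0"
    using t(1) unfolding f_def by (simp add: \<phi>_pCons \<phi>_0 power2_eq_square algebra_simps)
  have \<phi>_linear: "\<phi> [:a, b:] = to_ac (a - b) + to_ac b * t" for a b
    by (simp add: \<phi>_pCons \<phi>_0 algebra_simps)
  have mod_f: "\<exists>a b. p mod f = [:a, b:] \<and> \<phi> p = \<phi> [:a, b:]" for p
  proof -
    have "Polynomial.degree (p mod f) < 2"
      using degree_mod_less'[of f p] by (cases "p mod f = 0") (simp_all add: f_def)
    then have "p mod f = [:poly.coeff (p mod f) 0, poly.coeff (p mod f) 1:]"
      by (intro poly_eqI) (auto simp: coeff_pCons Polynomial.coeff_eq_0 split: nat.splits)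
    then obtain a b where ab: "p mod f = [:a, b:]"
      by blast
    have "\<phi> p = \<phi> (p div f * f) + \<phi> (p mod f)"
      by (simp flip: \<phi>_add)
    then have "\<phi> p = \<phi> [:a, b:]"
      by (simp add: \<phi>_mult \<phi>_f ab)
    with ab show ?thesis by blast
  qed
  have range: "range \<phi> = adjoin_root t"
  proof
    show "range \<phi> \<subseteq> adjoin_root t"
      using mod_f \<phi>_linear by (metis adjoin_rootI image_subsetI)
    show "adjoin_root t \<subseteq> range \<phi>"
    proof
      fix x assume "x \<in> adjoin_root t"
      then obtain a b where "x = to_ac a + to_ac b * t" by (rule adjoin_rootE)
      then have "x = \<phi> [:a + b, b:]" by (simp only: \<phi>_linear add_diff_cancel_right')
      then show "x \<in> range \<phi>" by blast
    qed
  qed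
  \<comment> \<open>This is where t outside \<open>Q2\<close> enters: 1 and t are then independent,
    so a linear remainder that vanishes at t - 1 is zero.\<close>
  have kernel: "\<phi> p = 0 \<longleftrightarrow> f dvd p" for p
  proof
    assume p: "\<phi> p = 0"
    obtain a b where ab: "p mod f = [:a, b:]" "\<phi> p = \<phi> [:a, b:]" using mod_f by blast
    then have "to_ac (a - b) + to_ac b * t = to_ac 0 + to_ac 0 * t"
      using p \<phi>_linear by simp
    then have "a = 0 \<and> b = 0"
      using adjoin_root_coordinates_unique[OF t(2)] by fastforce
    then show "f dvd p" using ab by (simp add: dvd_eq_mod_eq_0)
  next
    assume "f dvd p"
    then show "\<phi> p = 0" by (auto simp: dvd_def \<phi>_mult \<phi>_f)
  qed
  interpret R: cring "ring_of_type_algebra :: q2 poly ring" ..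
  interpret S: field Q2_closure ..
  interpret ring_hom_ring "ring_of_type_algebra :: q2 poly ring" Q2_closure \<phi>
    by (rule ring_hom_ringI) (auto simp: \<phi>_mult \<phi>_add R.ring_axioms S.ring_axioms, simp add: \<phi>_def)
  have ker: "a_kernel ring_of_type_algebra Q2_closure \<phi> = PIdl\<^bsub>ring_of_type_algebra\<^esub> f"
    unfolding PIdl_poly a_kernel_def' using kernel by simp
  \<comment> \<open>The homomorphism theorem gives a map out of the quotient, whereas
    \<open>Q2_isomorphic\<close> asks for one into it; hence the \<open>inv_into\<close> below,
    whose values on constants are checked through \<psi>.\<close>
  define \<psi> where "\<psi> A = the_elem (\<phi> ` A)" for A
  have \<psi>: "\<psi> \<in> ring_iso (quotient_ring f) (subring_of_closure (adjoin_root t))"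
    using FactRing_iso_set_aux unfolding ker \<psi>_def quotient_ring_def by (simp add: range)
  have ring: "ring (quotient_ring f)"
    unfolding quotient_ring_def using ideal.quotient_is_ring[OF R.cgenideal_ideal] by simp
  have const: "inv_into (carrier (quotient_ring f)) \<psi> (to_ac c) = quotient_const f c" for c
  proof (rule inv_into_f_eq)
    show "inj_on \<psi> (carrier (quotient_ring f))"
      using \<psi> unfolding ring_iso_def bij_betw_def by blast
    show "quotient_const f c \<in> carrier (quotient_ring f)"
      unfolding quotient_const_def quotient_ring_def FactRing_def A_RCOSETS_def' by auto
    show "\<psi> (quotient_const f c) = to_ac c"
      unfolding \<psi>_def quotient_const_def ker[symmetric] by (simp add: \<phi>_pCons \<phi>_0)
  qed
  show ?thesis
    unfolding Q2_isomorphic_def f_def[symmetric]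
    using ring_iso_set_sym[OF ring \<psi>] const by blast
qed

subsection \<open>The unramified extension\<close>

abbreviation z2_embed :: "z2 \<Rightarrow> q2_closure" where
  "z2_embed z \<equiv> to_ac (to_fract z)"

context
  fixes t :: q2_closure
  assumes t: "t\<^sup>2 = 5"
begin

text \<open>As 5 is 1 modulo 4, the integers are generated by (1 + t) / 2 and not by t. Its equation
  X^2 - X - 1 = 0 stays irreducible modulo 2, which keeps 2 prime.\<close>

definition golden :: q2_closure where
  "golden = (1 + t) / 2"

definition golden_integers :: "q2_closure set" where
  "golden_integers = range (\<lambda>(a, b). z2_embed a + z2_embed b * golden)"

lemma golden_integersI: "x = z2_embed a + z2_embed b * golden \<Longrightarrow> x \<in> golden_integers"
  unfolding golden_integers_def by auto

lemma golden_integersE: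
  assumes "x \<in> golden_integers"
  obtains a b where "x = z2_embed a + z2_embed b * golden"
  using assms unfolding golden_integers_def by auto

lemma golden_square: "golden * golden = golden + 1"
proof -
  have "(1 + t) * (1 + t) = 2 * (1 + t) + 4"
    using t by (simp add: power2_eq_square algebra_simps)
  then show ?thesis
    unfolding golden_def by (simp add: field_simps)
qed

lemma t_not_in_Q2: "t \<notin> Q2"
proof
  assume "t \<in> Q2"
  then obtain q where "t = to_ac q" by blast
  then have "to_ac (q\<^sup>2) = to_ac (to_fract 5)"
    using t by simp
  then have "q\<^sup>2 = to_fract 5"
    by (simp only: to_ac_eq_iff)
  then show False
    using q2_not_square[of 5 q] by simp
qed

lemma subfield_t: "subfield (adjoin_root t) Q2_closure"
  using subfield_adjoin_root[of t 5] t by simp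

lemma golden_mult:
  "(z2_embed a + z2_embed b * golden) * (z2_embed c + z2_embed d * golden) =
   z2_embed (a * c + b * d) + z2_embed (a * d + b * c + b * d) * golden"
proof -
  have "(A + B * golden) * (C + D * golden) = A * C + (A * D + B * C) * golden + B * D * (golden * golden)"
    for A B C D
    by (simp add: algebra_simps)
  then have "(A + B * golden) * (C + D * golden) = (A * C + B * D) + (A * D + B * C + B * D) * golden" for A B C D
    unfolding golden_square by (simp add: algebra_simps)
  then show ?thesis
    by simp
qed

lemma golden_basis_change:
  "z2_embed a + z2_embed b * golden = to_ac (to_fract a + to_fract b / 2) + to_ac (to_fract b / 2) * t"
proof -
  have "A + B * ((1 + t) / 2) = (A + B / 2) + B / 2 * t" for A B :: q2_closure
    by (simp add: distrib_left add_divide_distrib)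
  then show ?thesis
    unfolding golden_def by simp
qed

lemma golden_unique:
  assumes "z2_embed a + z2_embed b * golden = z2_embed c + z2_embed d * golden"
  shows "a = c \<and> b = d"
proof -
  have "to_fract a + to_fract b / 2 = to_fract c + to_fract d / 2 \<and> to_fract b / 2 = to_fract d / 2"
    using adjoin_root_coordinates_unique[OF t_not_in_Q2] assms unfolding golden_basis_change by blast
  then show ?thesis by auto
qed

lemma golden_integers_add: "x \<in> golden_integers \<Longrightarrow> y \<in> golden_integers \<Longrightarrow> x + y \<in> golden_integers"
proof (elim golden_integersE)
  fix a b c d
  assume "x = z2_embed a + z2_embed b * golden" "y = z2_embed c + z2_embed d * golden"
  then show ?thesis
    by (intro golden_integersI[of _ "a + c" "b + d"]) (simp add: algebra_simps)
qed

lemma golden_integers_mult: "x \<in> golden_integers \<Longrightarrow> y \<in> golden_integers \<Longrightarrow> x * y \<in> golden_integers"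
  by (elim golden_integersE) (simp only: golden_mult, rule golden_integersI, rule refl)

lemma golden_integers_minus: "x \<in> golden_integers \<Longrightarrow> - x \<in> golden_integers"
proof (elim golden_integersE)
  fix a b
  assume "x = z2_embed a + z2_embed b * golden"
  then show ?thesis
    by (intro golden_integersI[of _ "- a" "- b"]) (simp add: algebra_simps)
qed

lemma golden_integers_embed: "z2_embed a \<in> golden_integers"
  by (rule golden_integersI[of _ a 0]) simp

lemma golden_integers_poly:
  assumes "\<And>i. poly.coeff p i \<in> range z2_embed" "x \<in> golden_integers"
  shows "poly p x \<in> golden_integers"
  using assms(1)
proof (induction p)
  case 0
  then show ?case
    using golden_integers_embed[of 0] by simp
next
  case (pCons a p)
  have "a \<in> golden_integers"
    using pCons.prems[of 0] golden_integers_embed by auto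
  moreover have "poly p x \<in> golden_integers"
    using pCons.prems[of "Suc i" for i] by (intro pCons.IH) simp
  ultimately show ?case
    using assms(2) by (simp add: golden_integers_add golden_integers_mult)
qed

text \<open>Comparing coordinates would give 2 a = 1, against parity. That 2 is no unit serves both
  to bound the ring of integers and to make the ideal of 2 proper.\<close>

lemma half_not_golden_integer:
  assumes "y \<in> golden_integers"
  shows "2 * y \<noteq> 1"
proof
  assume "2 * y = 1"
  moreover obtain a b where "y = z2_embed a + z2_embed b * golden"
    using assms by (rule golden_integersE)
  ultimately have "z2_embed (2 * a) + z2_embed (2 * b) * golden = z2_embed 1 + z2_embed 0 * golden"
    by (simp add: algebra_simps)
  then have "2 * a = 1"
    using golden_unique by blast
  then have "reduce (2 * a) = 1"
    by simp
  then show False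
    by simp
qed

text \<open>The norm a^2 + a b - b^2 is odd unless a and b are both even, hence a unit here; the
  inverse is the conjugate (a + b) - b \<open>golden\<close> divided by it.\<close>

lemma golden_integers_inverse:
  assumes "reduce a = 1 \<or> reduce b = 1"
  obtains y where "y \<in> golden_integers" "(z2_embed a + z2_embed b * golden) * y = 1"
proof -
  have "reduce (a\<^sup>2 + a * b - b\<^sup>2) = 1"
    using assms by (cases "reduce a"; cases "reduce b") simp_all
  then obtain w where w: "(a\<^sup>2 + a * b - b\<^sup>2) * w = 1"
    by (rule z2_unit)
  define y where "y = z2_embed ((a + b) * w) + z2_embed (- b * w) * golden"
  have "a * ((a + b) * w) + b * (- b * w) = 1"
    using w by (simp add: power2_eq_square algebra_simps)
  moreover have "a * (- b * w) + b * ((a + b) * w) + b * (- b * w) = 0"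
    by (simp add: algebra_simps)
  ultimately have "(z2_embed a + z2_embed b * golden) * y = 1"
    unfolding y_def golden_mult by (simp only: to_fract_0 to_fract_1 to_ac_0 to_ac_1) simp
  then show ?thesis
    using that[of y] golden_integersI y_def by blast
qed

text \<open>The least power of 2 that clears denominators: if k > 0 and both coordinates were even,
  a factor 2 would cancel. So for k > 0 the right-hand side is a unit by
  \<open>golden_integers_inverse\<close>.\<close>

lemma golden_integers_primitive:
  assumes "x \<in> adjoin_root t"
  obtains k a b where "2 ^ k * x = z2_embed a + z2_embed b * golden"
    and "k = 0 \<or> reduce a = 1 \<or> reduce b = 1"
proof -
  define P where "P k \<longleftrightarrow> 2 ^ k * x \<in> golden_integers" for k
  obtain p q where x: "x = to_ac p + to_ac q * t"
    using assms by (rule adjoin_rootE)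
  obtain k1 z1 where z1: "2 ^ k1 * (p - q) = to_fract z1"
    by (rule q2_denominator)
  obtain k2 z2 where z2: "2 ^ k2 * (2 * q) = to_fract z2"
    by (rule q2_denominator)
  have "A + B * t = (A - B) + 2 * B * golden" for A B
    unfolding golden_def by (simp add: algebra_simps)
  then have "x = to_ac (p - q) + to_ac (2 * q) * golden"
    unfolding x by simp
  then have "2 ^ (k1 + k2) * x =
      2 ^ k2 * (2 ^ k1 * to_ac (p - q)) + 2 ^ k1 * (2 ^ k2 * to_ac (2 * q)) * golden"
    by (simp only: power_add) (simp only: algebra_simps)
  also have "2 ^ k1 * to_ac (p - q) = z2_embed z1"
    unfolding z1[symmetric] by simp
  also have "2 ^ k2 * to_ac (2 * q) = z2_embed z2"
    unfolding z2[symmetric] by simp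
  also have "2 ^ k2 * z2_embed z1 + 2 ^ k1 * z2_embed z2 * golden =
      z2_embed (2 ^ k2 * z1) + z2_embed (2 ^ k1 * z2) * golden"
    by simp
  finally have "P (k1 + k2)"
    unfolding P_def by (rule golden_integersI)
  then have "P (LEAST k. P k)"
    by (rule LeastI)
  moreover define k where "k = (LEAST k. P k)"
  ultimately obtain a b where ab: "2 ^ k * x = z2_embed a + z2_embed b * golden"
    unfolding P_def by (metis golden_integersE)
  have "k = 0 \<or> reduce a = 1 \<or> reduce b = 1"
  proof (rule ccontr)
    assume contr: "\<not> (k = 0 \<or> reduce a = 1 \<or> reduce b = 1)"
    then have "reduce a = 0" "reduce b = 0"
      by auto
    then obtain a' b' where "a = 2 * a'" "b = 2 * b'"
      using reduce_eq_0_iff by metis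
    moreover obtain l where l: "k = Suc l"
      using contr by (cases k) auto
    ultimately have "2 * (2 ^ l * x) = 2 * (z2_embed a' + z2_embed b' * golden)"
      using ab by (simp add: algebra_simps)
    then have "2 ^ l * x = z2_embed a' + z2_embed b' * golden"
      unfolding mult_cancel_left by simp
    then have "P l"
      unfolding P_def by (rule golden_integersI)
    then have "k \<le> l"
      unfolding k_def by (rule Least_le)
    with l show False by simp
  qed
  with ab show ?thesis
    by (rule that)
qed

text \<open>An element of the field outside \<open>golden_integers\<close> is a unit divided by a
  positive power of 2, and this is incompatible with a monic equation.\<close>

lemma integers_of_adjoin_sqrt5: "integers_of (adjoin_root t) = golden_integers"
proof
  show "golden_integers \<subseteq> integers_of (adjoin_root t)"
  proof
    fix x assume "x \<in> golden_integers"
    then obtain a b where x: "x = z2_embed a + z2_embed b * golden"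
      by (rule golden_integersE)
    \<comment> \<open>The characteristic polynomial: trace 2 a + b, norm a^2 + a b - b^2.\<close>
    define p where "p = [:a\<^sup>2 + a * b - b\<^sup>2, - (2 * a + b), 1:]"
    have "poly (map_poly (to_ac \<circ> to_fract) p) x = x * x - z2_embed (2 * a + b) * x + z2_embed (a\<^sup>2 + a * b - b\<^sup>2)"
      unfolding p_def by (simp add: map_poly_pCons algebra_simps)
    also have "\<dots> = 0"
      unfolding x golden_mult by (simp add: power2_eq_square golden_square algebra_simps)
    finally have "poly (map_poly (to_ac \<circ> to_fract) p) x = 0" .
    moreover have "Polynomial.lead_coeff p = 1"
      by (simp add: p_def)
    moreover have "x \<in> adjoin_root t"
      unfolding x golden_basis_change by (rule adjoin_rootI) (rule refl)
    ultimately show "x \<in> integers_of (adjoin_root t)"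
      unfolding integers_of_def by blast
  qed
next
  show "integers_of (adjoin_root t) \<subseteq> golden_integers"
  proof
    fix x assume "x \<in> integers_of (adjoin_root t)"
    then obtain p :: "z2 poly" where x: "x \<in> adjoin_root t" and p: "Polynomial.lead_coeff p = 1"
      "poly (map_poly (to_ac \<circ> to_fract) p) x = 0"
      unfolding integers_of_def by blast
    obtain k a b where k: "2 ^ k * x = z2_embed a + z2_embed b * golden"
      "k = 0 \<or> reduce a = 1 \<or> reduce b = 1"
      using x by (rule golden_integers_primitive)
    show "x \<in> golden_integers"
    proof (cases k)
      case 0
      then show ?thesis using k by (simp add: golden_integersI)
    next
      case (Suc l)
      then obtain z where z: "z \<in> golden_integers" "2 ^ k * x * z = 1"
        using k golden_integers_inverse[of a b] by (metis nat.distinct(1))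
      define y where "y = 2 ^ l * z"
      have y: "y \<in> golden_integers"
        using golden_integers_mult[OF golden_integers_embed[of "2 ^ l"] z(1)] by (simp add: y_def)
      have xy: "x * (2 * y) = 1"
        using z(2) Suc by (simp add: y_def mult_ac)
      txt \<open>As \<open>1 / x = 2 * y\<close> is a root of the reversed polynomial, whose constant term is \<open>1\<close>, the number \<open>1\<close> would be
        twice an element of \<open>golden_integers\<close>.\<close>
      define P where "P = map_poly (to_ac \<circ> to_fract) p"
      have lead: "Polynomial.lead_coeff P = 1"
        using p(1) unfolding P_def by (subst lead_coeff_map_poly_nz) simp_all
      have "inverse (2 * y) = x"
        using xy by (metis inverse_unique mult.commute)
      then have root: "poly (reflect_poly P) (2 * y) = 0"
        using xy p(2) poly_reflect_poly_nz[of "2 * y" P] unfolding P_def by fastforce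
      obtain c R where R: "reflect_poly P = pCons c R"
        by (cases "reflect_poly P")
      have "c = 1"
        using lead coeff_0_reflect_poly[of P] R by simp
      have "poly.coeff (reflect_poly P) i \<in> range z2_embed" for i
      proof -
        have "poly.coeff P j \<in> range z2_embed" for j
          unfolding P_def by (simp add: coeff_map_poly)
        moreover have "0 \<in> range z2_embed"
          using range_eqI[of _ z2_embed 0] by simp
        ultimately show ?thesis
          by (simp add: coeff_reflect_poly)
      qed
      then have "poly.coeff R i \<in> range z2_embed" for i
        unfolding R by (metis coeff_pCons_Suc)
      moreover have "2 * y \<in> golden_integers"
        using golden_integers_add[OF y y] by (simp only: mult_2)
      ultimately have "poly R (2 * y) \<in> golden_integers"
        by (rule golden_integers_poly)
      then have "- (y * poly R (2 * y)) \<in> golden_integers"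
        using y by (intro golden_integers_minus golden_integers_mult)
      moreover have "2 * - (y * poly R (2 * y)) = 1"
        using root unfolding R \<open>c = 1\<close> by (simp add: algebra_simps add_eq_0_iff)
      ultimately show ?thesis
        using half_not_golden_integer by blast
    qed
  qed
qed

text \<open>An integer outside the ideal of 2 has an odd coordinate and is a unit, so every strictly
  larger ideal contains 1.\<close>

lemma unramified_adjoin_sqrt5: "unramified_quadratic (adjoin_root t)"
proof -
  interpret field Q2_closure ..
  have "Q2 \<subset> adjoin_root t"
    using Q2_subset_adjoin_root t_not_in_Q2 adjoin_root_self by blast
  have "line_extension Q2 t Q2 = adjoin_root t"
    by (auto simp: line_extension_mem_iff adjoin_root_def add.commute image_iff) blast+
  moreover have "dimension (Suc 1) Q2 (line_extension Q2 t Q2)"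
    using dimension_one[OF subfield_Q2] t_not_in_Q2 by (intro Suc_dim) simp_all
  ultimately have dim: "dimension 2 Q2 (adjoin_root t)"
    by (simp add: numeral_2_eq_2)
  define R where "R = subring_of_closure golden_integers"
  have R_simps: "carrier R = golden_integers" "\<And>x y. x \<otimes>\<^bsub>R\<^esub> y = x * y" "\<one>\<^bsub>R\<^esub> = 1"
    unfolding R_def by simp_all
  have "subring golden_integers Q2_closure"
    using golden_integers_embed[of 1]
    by (intro subringI) (simp_all add: golden_integers_minus golden_integers_mult golden_integers_add)
  then have "cring R"
    unfolding R_def using subcring_iff subcringI' by simp
  then interpret R: cring R .
  have two: "2 \<in> golden_integers"
    using golden_integers_embed[of 2] by simp
  have PIdl: "PIdl\<^bsub>R\<^esub> 2 = {2 * x | x. x \<in> golden_integers}"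
    unfolding cgenideal_def R_simps by (auto simp: mult.commute)
  have "maximalideal (PIdl\<^bsub>R\<^esub> 2) R"
  proof (rule maximalidealI)
    show "ideal (PIdl\<^bsub>R\<^esub> 2) R"
      using two by (intro R.cgenideal_ideal) (simp add: R_simps)
    have "1 \<notin> PIdl\<^bsub>R\<^esub> 2"
    proof
      assume "1 \<in> PIdl\<^bsub>R\<^esub> 2"
      then obtain y where "y \<in> golden_integers" "1 = 2 * y"
        unfolding PIdl by blast
      then show False
        using half_not_golden_integer[of y] by simp
    qed
    then show "carrier R \<noteq> PIdl\<^bsub>R\<^esub> 2"
      using R.one_closed unfolding R_simps by blast
  next
    fix J assume J: "ideal J R" "PIdl\<^bsub>R\<^esub> 2 \<subseteq> J" "J \<subseteq> carrier R"
    show "J = PIdl\<^bsub>R\<^esub> 2 \<or> J = carrier R"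
    proof (cases "J \<subseteq> PIdl\<^bsub>R\<^esub> 2")
      case True
      with J show ?thesis by blast
    next
      case False
      then obtain x where x: "x \<in> J" "x \<notin> PIdl\<^bsub>R\<^esub> 2" by blast
      then have "x \<in> golden_integers"
        using J(3) R_simps by blast
      then obtain a b where ab: "x = z2_embed a + z2_embed b * golden"
        by (rule golden_integersE)
      have "reduce a = 1 \<or> reduce b = 1"
      proof (rule ccontr)
        assume "\<not> (reduce a = 1 \<or> reduce b = 1)"
        then have "reduce a = 0" "reduce b = 0" by auto
        then obtain a' b' where "a = 2 * a'" "b = 2 * b'"
          using reduce_eq_0_iff by metis
        then have "x = 2 * (z2_embed a' + z2_embed b' * golden)"
          unfolding ab by (simp add: algebra_simps)
        then have "x \<in> PIdl\<^bsub>R\<^esub> 2"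
          unfolding PIdl using golden_integersI by blast
        with x show False by blast
      qed
      then obtain y where "y \<in> golden_integers" "x * y = 1"
        unfolding ab by (rule golden_integers_inverse)
      then have "\<one>\<^bsub>R\<^esub> \<in> J"
        using ideal.I_r_closed[OF J(1) x(1), of y] by (simp add: R_simps)
      then show ?thesis
        using ideal.one_imp_carrier[OF J(1)] by blast
    qed
  qed
  then show ?thesis
    unfolding unramified_quadratic_def integers_of_adjoin_sqrt5 R_def
    using subfield_t Q2_subset_adjoin_root dim by blast
qed

lemma isomorphic_to_Q4_adjoin_sqrt5: "isomorphic_to_Q4 (adjoin_root t)"
proof -
  have "id \<in> ring_iso (subring_of_closure (adjoin_root t)) (subring_of_closure (adjoin_root t))"
    by (rule ring_iso_set_refl)
  then show ?thesis
    unfolding isomorphic_to_Q4_def Q2_isomorphic_def using unramified_adjoin_sqrt5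
    by (intro exI[of _ "adjoin_root t"] conjI bexI[of _ id]) simp_all
qed

end

section \<open>The 2-torsion of a Weierstrass curve\<close>

definition b\<^sub>2 :: "'a :: comm_ring_1 weierstrass \<Rightarrow> 'a" where
  "b\<^sub>2 E = (a\<^sub>1 E)\<^sup>2 + 4 * a\<^sub>2 E"

definition b\<^sub>4 :: "'a :: comm_ring_1 weierstrass \<Rightarrow> 'a" where
  "b\<^sub>4 E = 2 * a\<^sub>4 E + a\<^sub>1 E * a\<^sub>3 E"

definition b\<^sub>6 :: "'a :: comm_ring_1 weierstrass \<Rightarrow> 'a" where
  "b\<^sub>6 E = (a\<^sub>3 E)\<^sup>2 + 4 * a\<^sub>6 E"

definition two_division_poly :: "'a :: comm_ring_1 weierstrass \<Rightarrow> 'a \<Rightarrow> 'a" where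
  "two_division_poly E x = 4 * x ^ 3 + b\<^sub>2 E * x\<^sup>2 + 2 * b\<^sub>4 E * x + b\<^sub>6 E"

text \<open>The factor 4 eliminates b8, as 4 b8 = b2 b6 - b4^2, and leaves a polynomial in b2, b4,
  b6.\<close>

lemma four_discriminant:
  fixes E :: "'a :: idom weierstrass"
  shows
  "4 * discriminant E = - (b\<^sub>2 E)\<^sup>2 * (b\<^sub>2 E * b\<^sub>6 E - (b\<^sub>4 E)\<^sup>2) - 32 * b\<^sub>4 E ^ 3 - 108 * (b\<^sub>6 E)\<^sup>2
     + 36 * b\<^sub>2 E * b\<^sub>4 E * b\<^sub>6 E"
  unfolding discriminant_def Let_def b\<^sub>2_def b\<^sub>4_def b\<^sub>6_def by Groebner_Basis.algebra

lemma b_map_to_ac: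
  "b\<^sub>2 (map_weierstrass to_ac E) = to_ac (b\<^sub>2 E)"
  "b\<^sub>4 (map_weierstrass to_ac E) = to_ac (b\<^sub>4 E)"
  "b\<^sub>6 (map_weierstrass to_ac E) = to_ac (b\<^sub>6 E)"
  by (simp_all add: b\<^sub>2_def b\<^sub>4_def b\<^sub>6_def weierstrass.map_sel)

lemma b_map_to_fract:
  "b\<^sub>2 (map_weierstrass to_fract W) = to_fract (b\<^sub>2 W)"
  "b\<^sub>4 (map_weierstrass to_fract W) = to_fract (b\<^sub>4 W)"
  "b\<^sub>6 (map_weierstrass to_fract W) = to_fract (b\<^sub>6 W)"
  for W :: "z2 weierstrass"
  by (simp_all add: b\<^sub>2_def b\<^sub>4_def b\<^sub>6_def weierstrass.map_sel)

lemma discriminant_map_to_fract: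
  "discriminant (map_weierstrass to_fract W) = to_fract (discriminant W)" for W :: "z2 weierstrass"
  by (simp add: discriminant_def Let_def weierstrass.map_sel)

lemma discriminant_map_reduce:
  "discriminant (map_weierstrass reduce W) = reduce (discriminant W)"
  by (simp add: discriminant_def Let_def weierstrass.map_sel)

text \<open>Only u and r survive: s and t merely change y, and completing the square in y forgets
  such changes. Rational roots of the cubic are thus transported, and u^12 preserves the square
  class of the discriminant.\<close>

lemma isomorphic_curves_two_division:
  fixes E E' :: "'a :: field_char_0 weierstrass"
  assumes "isomorphic_curves E E'"
  obtains u r where "u \<noteq> 0" "discriminant E = u ^ 12 * discriminant E'"
    and "\<And>x. two_division_poly E (u\<^sup>2 * x + r) = u ^ 6 * two_division_poly E' x"
proof -
  obtain u r s t where u: "u \<noteq> 0" and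
     a1: "u * a\<^sub>1 E' = a\<^sub>1 E + 2 * s" and
     a2: "u\<^sup>2 * a\<^sub>2 E' = a\<^sub>2 E - s * a\<^sub>1 E + 3 * r - s\<^sup>2" and
     a3: "u ^ 3 * a\<^sub>3 E' = a\<^sub>3 E + r * a\<^sub>1 E + 2 * t" and
     a4: "u ^ 4 * a\<^sub>4 E' = a\<^sub>4 E - s * a\<^sub>3 E + 2 * r * a\<^sub>2 E - (t + r * s) * a\<^sub>1 E + 3 * r\<^sup>2 - 2 * s * t" and
     a6: "u ^ 6 * a\<^sub>6 E' = a\<^sub>6 E + r * a\<^sub>4 E + r\<^sup>2 * a\<^sub>2 E + r ^ 3 - t * a\<^sub>3 E - t\<^sup>2 - r * t * a\<^sub>1 E"
    using assms unfolding isomorphic_curves_def by blast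
  have "u\<^sup>2 * b\<^sub>2 E' = (u * a\<^sub>1 E')\<^sup>2 + 4 * (u\<^sup>2 * a\<^sub>2 E')"
    unfolding b\<^sub>2_def by Groebner_Basis.algebra
  also have "\<dots> = b\<^sub>2 E + 12 * r"
    unfolding a1 a2 b\<^sub>2_def by Groebner_Basis.algebra
  finally have b2: "b\<^sub>2 E = u\<^sup>2 * b\<^sub>2 E' - 12 * r"
    by simp
  have "u ^ 4 * b\<^sub>4 E' = 2 * (u ^ 4 * a\<^sub>4 E') + (u * a\<^sub>1 E') * (u ^ 3 * a\<^sub>3 E')"
    unfolding b\<^sub>4_def by Groebner_Basis.algebra
  also have "\<dots> = b\<^sub>4 E + r * b\<^sub>2 E + 6 * r\<^sup>2"
    unfolding a1 a3 a4 b\<^sub>2_def b\<^sub>4_def by Groebner_Basis.algebra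
  finally have b4: "b\<^sub>4 E = u ^ 4 * b\<^sub>4 E' - r * (u\<^sup>2 * b\<^sub>2 E' - 12 * r) - 6 * r\<^sup>2"
    unfolding b2 by simp
  have "u ^ 6 * b\<^sub>6 E' = (u ^ 3 * a\<^sub>3 E')\<^sup>2 + 4 * (u ^ 6 * a\<^sub>6 E')"
    unfolding b\<^sub>6_def by Groebner_Basis.algebra
  also have "\<dots> = b\<^sub>6 E + 2 * r * b\<^sub>4 E + r\<^sup>2 * b\<^sub>2 E + 4 * r ^ 3"
    unfolding a3 a6 b\<^sub>2_def b\<^sub>4_def b\<^sub>6_def by Groebner_Basis.algebra
  finally have b6: "b\<^sub>6 E = u ^ 6 * b\<^sub>6 E' - 2 * r * (u ^ 4 * b\<^sub>4 E' - r * (u\<^sup>2 * b\<^sub>2 E' - 12 * r) - 6 * r\<^sup>2)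
      - r\<^sup>2 * (u\<^sup>2 * b\<^sub>2 E' - 12 * r) - 4 * r ^ 3"
    unfolding b2 b4 by Groebner_Basis.algebra
  have "4 * discriminant E = u ^ 12 * (4 * discriminant E')"
    unfolding four_discriminant b2 b4 b6 by Groebner_Basis.algebra
  then have "discriminant E = u ^ 12 * discriminant E'"
    by simp
  moreover have "two_division_poly E (u\<^sup>2 * x + r) = u ^ 6 * two_division_poly E' x" for x
    unfolding two_division_poly_def b2 b4 b6 by Groebner_Basis.algebra
  ultimately show ?thesis
    using u that by blast
qed

text \<open>The ordinate solves 2 y + a1 x + a3 = 0, the condition P = -P.\<close>

definition torsion_point :: "'a :: field weierstrass \<Rightarrow> 'a \<Rightarrow> 'a point" where
  "torsion_point E x = Affine x (- (a\<^sub>1 E * x + a\<^sub>3 E) / 2)"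

text \<open>Completing the square turns the curve equation into (2 y + a1 x + a3)^2 =
  \<open>two_division_poly\<close> at x, and an affine point is its own negative exactly when the
  bracket vanishes.\<close>

lemma two_torsion_eq:
  fixes E :: "'a :: field_char_0 weierstrass"
  defines "E' \<equiv> map_weierstrass to_ac E"
  shows "two_torsion E = insert Origin (torsion_point E' ` {x. two_division_poly E' x = 0})"
proof (rule Set.set_eqI)
  fix P
  show "P \<in> two_torsion E \<longleftrightarrow> P \<in> insert Origin (torsion_point E' ` {x. two_division_poly E' x = 0})"
  proof (cases P)
    case Origin
    then show ?thesis
      by (simp add: two_torsion_def)
  next
    case (Affine x y)
    have "P \<in> two_torsion E \<longleftrightarrow> on_curve E' P \<and> y + y + a\<^sub>1 E' * x + a\<^sub>3 E' = 0"
      unfolding two_torsion_def E'_def Affine by (simp add: Let_def)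
    also have "\<dots> \<longleftrightarrow> y = - (a\<^sub>1 E' * x + a\<^sub>3 E') / 2 \<and> two_division_poly E' x = 0"
    proof -
      have y: "y + y + a\<^sub>1 E' * x + a\<^sub>3 E' = 0 \<longleftrightarrow> y = - (a\<^sub>1 E' * x + a\<^sub>3 E') / 2"
        by (simp add: field_simps add_eq_0_iff)
      have "on_curve E' P \<longleftrightarrow> two_division_poly E' x = 0" if "y + y + a\<^sub>1 E' * x + a\<^sub>3 E' = 0"
      proof -
        have a3: "a\<^sub>3 E' = - (y + y + a\<^sub>1 E' * x)"
          using that by Groebner_Basis.algebra
        have "two_division_poly E' x = 4 * (x ^ 3 + a\<^sub>2 E' * x\<^sup>2 + a\<^sub>4 E' * x + a\<^sub>6 E' -
            (y\<^sup>2 + a\<^sub>1 E' * x * y + a\<^sub>3 E' * y))"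
          unfolding two_division_poly_def b\<^sub>2_def b\<^sub>4_def b\<^sub>6_def a3 by Groebner_Basis.algebra
        then show ?thesis
          unfolding Affine on_curve.simps by (simp only: mult_eq_0_iff) auto
      qed
      then show ?thesis
        using y by blast
    qed
    also have "\<dots> \<longleftrightarrow> P \<in> insert Origin (torsion_point E' ` {x. two_division_poly E' x = 0})"
      unfolding Affine torsion_point_def by auto
    finally show ?thesis .
  qed
qed

text \<open>P and R come from dividing the cubic by x - e. The second claim is the discriminant rule
  for a linear times a quadratic factor, the bracket squared being the quadratic at e.\<close>

lemma two_division_poly_factor:
  fixes E :: "'a :: field_char_0 weierstrass"
  assumes e: "two_division_poly E e = 0"
    and P: "P = b\<^sub>2 E + 4 * e" and R: "R = 2 * b\<^sub>4 E + e * P"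
  shows "two_division_poly E x = (x - e) * (4 * x\<^sup>2 + P * x + R)"
    and "(P\<^sup>2 - 16 * R) * (4 * e\<^sup>2 + P * e + R)\<^sup>2 = 16 * discriminant E"
proof -
  have b6: "b\<^sub>6 E = - (4 * e ^ 3 + b\<^sub>2 E * e\<^sup>2 + 2 * b\<^sub>4 E * e)"
    using e unfolding two_division_poly_def by Groebner_Basis.algebra
  show "two_division_poly E x = (x - e) * (4 * x\<^sup>2 + P * x + R)"
    unfolding two_division_poly_def b6 P R by Groebner_Basis.algebra
  have "4 * (16 * discriminant E) = 4 * ((P\<^sup>2 - 16 * R) * (4 * e\<^sup>2 + P * e + R)\<^sup>2)"
    unfolding mult.left_commute[of 4 16] four_discriminant b6 P R by Groebner_Basis.algebra
  then show "(P\<^sup>2 - 16 * R) * (4 * e\<^sup>2 + P * e + R)\<^sup>2 = 16 * discriminant E"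
    by simp
qed

text \<open>A nonzero discriminant makes the quadratic factor nonzero at e, so its roots differ from
  e; its own discriminant is c times a nonzero square.\<close>

lemma two_torsion_structure:
  fixes E :: "q2 weierstrass"
  assumes e: "two_division_poly E e = 0" and disc: "discriminant E \<noteq> 0"
    and w: "discriminant E * c = w\<^sup>2" and c: "c \<noteq> 0" and t: "t\<^sup>2 = to_ac c"
  obtains m n where "n \<noteq> 0"
    and "two_torsion E = insert Origin (torsion_point (map_weierstrass to_ac E) `
           {to_ac e, to_ac m + to_ac n * t, to_ac m - to_ac n * t})"
    and "to_ac e \<notin> {to_ac m + to_ac n * t, to_ac m - to_ac n * t}"
proof -
  define P where "P = b\<^sub>2 E + 4 * e"
  define R where "R = 2 * b\<^sub>4 E + e * P"
  define Q where "Q = 4 * e\<^sup>2 + P * e + R"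
  have PRQ: "(P\<^sup>2 - 16 * R) * Q\<^sup>2 = 16 * discriminant E"
    unfolding Q_def using two_division_poly_factor(2)[OF e P_def R_def] .
  then have Q: "Q \<noteq> 0"
    using disc by auto
  \<comment> \<open>The roots of the quadratic factor are (-P + s) / 8 and (-P - s) / 8, where s^2 =
    P^2 - 16 R = 16 w^2 / (c Q^2), so that s = 4 w t / (c Q).\<close>
  define m where "m = - P / 8"
  define n where "n = w / (2 * c * Q)"
  have "w \<noteq> 0"
    using w c disc by auto
  then have n: "n \<noteq> 0"
    unfolding n_def using c Q by simp
  have "64 * n\<^sup>2 * c * (c * Q\<^sup>2) = 16 * w\<^sup>2"
    unfolding n_def using c Q by (simp add: power_divide power_mult_distrib power2_eq_square)
  also have "\<dots> = (P\<^sup>2 - 16 * R) * (c * Q\<^sup>2)"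
    using w PRQ by Groebner_Basis.algebra
  finally have nc: "64 * n\<^sup>2 * c = P\<^sup>2 - 16 * R"
    using c Q by simp
  have quad: "16 * (4 * x\<^sup>2 + to_ac P * x + to_ac R) = 64 * ((x - to_ac m - to_ac n * t) * (x - to_ac m + to_ac n * t))" for x
  proof -
    have P: "to_ac P = - 8 * to_ac m"
      unfolding m_def by simp
    have "to_ac (64 * n\<^sup>2 * c) = to_ac (P\<^sup>2 - 16 * R)"
      unfolding nc ..
    then have "64 * (to_ac n)\<^sup>2 * t\<^sup>2 = (to_ac P)\<^sup>2 - 16 * to_ac R"
      unfolding t by simp
    then show ?thesis
      unfolding P by Groebner_Basis.algebra
  qed
  have quad_0: "4 * x\<^sup>2 + to_ac P * x + to_ac R = 0 \<longleftrightarrow> x \<in> {to_ac m + to_ac n * t, to_ac m - to_ac n * t}" for x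
  proof -
    have "4 * x\<^sup>2 + to_ac P * x + to_ac R = 0 \<longleftrightarrow> 16 * (4 * x\<^sup>2 + to_ac P * x + to_ac R) = 0"
      unfolding mult_eq_0_iff by simp
    also have "\<dots> \<longleftrightarrow> x - to_ac m - to_ac n * t = 0 \<or> x - to_ac m + to_ac n * t = 0"
      unfolding quad by simp
    also have "\<dots> \<longleftrightarrow> x = to_ac m + to_ac n * t \<or> x = to_ac m - to_ac n * t"
      by (simp add: algebra_simps eq_diff_eq)
    finally show ?thesis by simp
  qed
  define E' where "E' = map_weierstrass to_ac E"
  have "two_division_poly E' (to_ac e) = to_ac (two_division_poly E e)"
    unfolding two_division_poly_def E'_def b_map_to_ac by simp
  then have "two_division_poly E' (to_ac e) = 0"
    using e by simp
  then have "two_division_poly E' x = (x - to_ac e) * (4 * x\<^sup>2 + to_ac P * x + to_ac R)" for x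
    by (rule two_division_poly_factor(1)) (simp_all add: P_def R_def E'_def b_map_to_ac)
  then have "{x. two_division_poly E' x = 0} = {to_ac e, to_ac m + to_ac n * t, to_ac m - to_ac n * t}"
    using quad_0 by auto
  then have "two_torsion E = insert Origin (torsion_point E' `
      {to_ac e, to_ac m + to_ac n * t, to_ac m - to_ac n * t})"
    unfolding two_torsion_eq E'_def by simp
  moreover have "to_ac e \<notin> {to_ac m + to_ac n * t, to_ac m - to_ac n * t}"
  proof -
    have "to_ac Q \<noteq> 0" using Q by simp
    then have "4 * (to_ac e)\<^sup>2 + to_ac P * to_ac e + to_ac R \<noteq> 0"
      unfolding Q_def by simp
    then show ?thesis
      unfolding quad_0 .
  qed
  ultimately show ?thesis
    using n that unfolding E'_def by blast
qed

section \<open>Fields generated by 2-torsion points\<close>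

lemma coordinates_torsion_point:
  assumes "subfield K Q2_closure" "Q2 \<subseteq> K" "x \<in> K"
  shows "coordinates (torsion_point (map_weierstrass to_ac E) x) \<subseteq> K"
proof -
  have Q2: "to_ac c \<in> K" for c
    using assms(2) by blast
  have "to_ac (- a\<^sub>1 E / 2) * x + to_ac (- a\<^sub>3 E / 2) \<in> K"
    by (rule Q2_closure_subfieldD(1)[OF assms(1) Q2_closure_subfieldD(2)[OF assms(1) Q2 assms(3)] Q2])
  also have "to_ac (- a\<^sub>1 E / 2) * x + to_ac (- a\<^sub>3 E / 2) =
      - (a\<^sub>1 (map_weierstrass to_ac E) * x + a\<^sub>3 (map_weierstrass to_ac E)) / 2"
    by (simp add: weierstrass.map_sel add_divide_distrib diff_divide_distrib)
  finally show ?thesis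
    using assms(3) by (simp add: torsion_point_def)
qed

lemma Q2_adjoin_rational_point: "Q2_adjoin {torsion_point (map_weierstrass to_ac E) (to_ac e)} = Q2"
  using coordinates_torsion_point[OF subfield_Q2, of "to_ac e" E]
  by (intro Q2_adjoin_eqI subfield_Q2) auto

lemma Q2_adjoin_Origin: "Q2_adjoin {Origin} = Q2"
  by (intro Q2_adjoin_eqI subfield_Q2) auto

text \<open>A point with abscissa m + n t already brings in t, as n is nonzero. Leaving S free
  covers the whole 2-torsion and single points alike; the conjugate point is the case of -n.\<close>

lemma Q2_adjoin_eq_adjoin_root:
  assumes t: "t\<^sup>2 = to_ac c" and n: "n \<noteq> 0"
    and S: "torsion_point (map_weierstrass to_ac E) (to_ac m + to_ac n * t) \<in> S"
      "S \<subseteq> insert Origin (torsion_point (map_weierstrass to_ac E) ` adjoin_root t)"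
  shows "Q2_adjoin S = adjoin_root t"
proof (rule Q2_adjoin_eqI[OF subfield_adjoin_root[OF t]])
  have "coordinates P \<subseteq> adjoin_root t" if "P \<in> S" for P
    using S(2) that coordinates_torsion_point[OF subfield_adjoin_root[OF t] Q2_subset_adjoin_root] by fastforce
  then show "Q2 \<union> (\<Union>P\<in>S. coordinates P) \<subseteq> adjoin_root t"
    using Q2_subset_adjoin_root by blast
next
  fix L
  assume L: "subfield L Q2_closure" "Q2 \<union> (\<Union>P\<in>S. coordinates P) \<subseteq> L"
  have "to_ac m + to_ac n * t \<in> coordinates (torsion_point (map_weierstrass to_ac E) (to_ac m + to_ac n * t))"
    by (simp add: torsion_point_def)
  then have "to_ac m + to_ac n * t \<in> L"
    using L(2) S(1) by blast
  then show "adjoin_root t \<subseteq> L"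
    using adjoin_root_affine[OF t n L(1)] L(2) by blast
qed

section \<open>Good ordinary reduction\<close>

text \<open>In characteristic 2 the condition 2 y + a1 x + a3 = 0 loses y. If a1 reduced to 0, an
  affine 2-torsion point would force a3 to do so too, and then the discriminant vanishes.\<close>

lemma ordinary_reduction_a1:
  assumes "elliptic_curve (map_weierstrass reduce W)" "two_torsion (map_weierstrass reduce W) \<noteq> {Origin}"
  shows "reduce (a\<^sub>1 W) = 1"
proof (rule ccontr)
  assume "reduce (a\<^sub>1 W) \<noteq> 1"
  then have a1: "reduce (a\<^sub>1 W) = 0" by simp
  have "Origin \<in> two_torsion (map_weierstrass reduce W)"
    by (simp add: two_torsion_def)
  then obtain P where P: "P \<in> two_torsion (map_weierstrass reduce W)" "P \<noteq> Origin"
    using assms(2) by blast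
  then obtain x y where "P = Affine x y"
    by (cases P) auto
  then have "y + y + to_ac (reduce (a\<^sub>1 W)) * x + to_ac (reduce (a\<^sub>3 W)) = 0"
    using P(1) unfolding two_torsion_def by (simp add: Let_def weierstrass.map_sel split: if_splits)
  moreover have "y + y = 0"
  proof -
    have "(2 :: bit) = 0" by simp
    then have "(2 :: bit alg_closure) = 0"
      by (metis to_ac_0 to_ac_numeral)
    then show ?thesis by (simp flip: mult_2)
  qed
  ultimately have "reduce (a\<^sub>3 W) = 0"
    using a1 by simp
  then have "discriminant (map_weierstrass reduce W) = 0"
    using a1 by (simp add: discriminant_def Let_def weierstrass.map_sel)
  then show False
    using assms(1) unfolding elliptic_curve_def by blast
qed

text \<open>After the substitution \<open>x = 1 / (4 * z)\<close> the 2-division polynomial has odd linear coefficient and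
  even higher ones, so its root is found as a fixed point.\<close>

lemma rational_two_division_root:
  assumes "reduce (a\<^sub>1 W) = 1"
  obtains x where "two_division_poly (map_weierstrass to_fract W) x = 0"
proof -
  have "reduce (b\<^sub>2 W) = 1"
    using assms by (simp add: b\<^sub>2_def)
  then obtain m where m: "b\<^sub>2 W = 1 + 2 * m"
    using reduce_eq_1_iff by blast
  \<comment> \<open>The cubic at 1 / (4 z), multiplied by 16 z^3, is 1 + b2 z + 8 b4 z^2 + 16 b6
    z^3. With b2 = 1 + 2 m its vanishing reads z = -1 + 2 \<open>h z\<close>.\<close>
  define h where "h z = - (m * z + 4 * b\<^sub>4 W * (z * z) + 8 * b\<^sub>6 W * (z * z * z))" for z
  obtain z where "z = - 1 + 2 * h z"
    by (rule z2_fixed_point[of h "- 1"]) (simp add: h_def residue_simps)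
  then have "1 + b\<^sub>2 W * z + 8 * b\<^sub>4 W * z\<^sup>2 + 16 * b\<^sub>6 W * z ^ 3 = 0"
    unfolding h_def m by Groebner_Basis.algebra
  then have "to_fract (1 + b\<^sub>2 W * z + 8 * b\<^sub>4 W * z\<^sup>2 + 16 * b\<^sub>6 W * z ^ 3) = 0"
    by simp
  then have z: "1 + to_fract (b\<^sub>2 W) * to_fract z + 8 * to_fract (b\<^sub>4 W) * to_fract z ^ 2
      + 16 * to_fract (b\<^sub>6 W) * to_fract z ^ 3 = 0"
    by simp
  define x where "x = 1 / (4 * to_fract z)"
  have "to_fract z \<noteq> 0"
    using z by auto
  then have x: "4 * x * to_fract z = 1"
    by (simp add: x_def)
  have "two_division_poly (map_weierstrass to_fract W) x = 0"
    unfolding two_division_poly_def b_map_to_fract using z x by Groebner_Basis.algebra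
  then show ?thesis
    by (rule that)
qed

lemma good_ordinary_reduction_square_class:
  assumes "good_ordinary_reduction E"
  obtains e c w where "two_division_poly E e = 0" "c \<in> {1, 5, -1, -5}"
    and "discriminant E * to_fract c = w\<^sup>2"
proof -
  obtain W where W: "isomorphic_curves E (map_weierstrass to_fract W)"
      "elliptic_curve (map_weierstrass reduce W)" "two_torsion (map_weierstrass reduce W) \<noteq> {Origin}"
    using assms unfolding good_ordinary_reduction_def good_model_def by blast
  obtain x where x: "two_division_poly (map_weierstrass to_fract W) x = 0"
    using ordinary_reduction_a1[OF W(2,3)] by (rule rational_two_division_root)
  have "reduce (discriminant W) = 1"
    using W(2) by (simp add: elliptic_curve_def discriminant_map_reduce)
  then obtain c w where c: "c \<in> {1, 5, -1, -5}" "discriminant W * c = w\<^sup>2"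
    by (rule odd_square_class)
  obtain u r where u: "discriminant E = u ^ 12 * discriminant (map_weierstrass to_fract W)"
      "two_division_poly E (u\<^sup>2 * x + r) = u ^ 6 * two_division_poly (map_weierstrass to_fract W) x" for x
    using isomorphic_curves_two_division[OF W(1)] by metis
  have "discriminant E * to_fract c = u ^ 12 * to_fract (discriminant W * c)"
    unfolding u(1) discriminant_map_to_fract by simp
  also have "\<dots> = (u ^ 6 * to_fract w)\<^sup>2"
    unfolding c(2) by (simp add: power_mult_distrib flip: power_mult)
  finally show ?thesis
    using that[of "u\<^sup>2 * x + r" c] u(2)[of x] x c(1) by simp
qed

theorem theorem2p4:
  fixes E :: "q2 weierstrass"
  assumes "elliptic_curve E" and "good_ordinary_reduction E"
  shows "let F = two_division_field E in
    (isomorphic_to_Q2 F \<or> isomorphic_to_Q4 F \<or> isomorphic_to_L1 F \<or> isomorphic_to_L2 F) \<and>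
    (isomorphic_to_Q4 F \<or> isomorphic_to_L1 F \<or> isomorphic_to_L2 F \<longrightarrow>
      card {P \<in> two_torsion E. Q2_adjoin {P} = Q2} = 2 \<and>
      card {P \<in> two_torsion E. Q2_adjoin {P} \<noteq> Q2} = 2 \<and>
      (\<forall>P \<in> two_torsion E. Q2_adjoin {P} \<noteq> Q2 \<longrightarrow> Q2_adjoin {P} = F))"
proof -
  obtain e c w where e: "two_division_poly E e = 0" and c: "c \<in> {1, 5, -1, -5}"
    and w: "discriminant E * to_fract c = w\<^sup>2"
    using assms(2) by (rule good_ordinary_reduction_square_class)
  obtain t where t: "t\<^sup>2 = to_ac (to_fract c)"
    using nth_root_exists[of 2 "to_ac (to_fract c)"] by auto
  have c0: "to_fract c \<noteq> 0" and disc: "discriminant E \<noteq> 0"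
    using c assms(1) by (auto simp: elliptic_curve_def)
  define T where "T = torsion_point (map_weierstrass to_ac E)"
  have T_eq: "T x = T y \<longleftrightarrow> x = y" for x y
    by (auto simp: T_def torsion_point_def)
  have T_Origin: "Origin \<noteq> T x" for x
    by (simp add: T_def torsion_point_def)
  obtain m n where n: "n \<noteq> 0"
    and two_torsion: "two_torsion E =
      insert Origin (T ` {to_ac e, to_ac m + to_ac n * t, to_ac m - to_ac n * t})"
    and distinct: "to_ac e \<notin> {to_ac m + to_ac n * t, to_ac m - to_ac n * t}"
    using two_torsion_structure[OF e disc w c0 t] unfolding T_def by metis
  have roots: "to_ac m + to_ac n * t \<in> adjoin_root t" "to_ac m - to_ac n * t \<in> adjoin_root t"
    "to_ac e \<in> adjoin_root t"
    using adjoin_rootI[of _ m n] adjoin_rootI[of _ m "- n"] adjoin_rootI[of _ e 0] by simp_all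
  have F: "two_division_field E = adjoin_root t"
    unfolding two_division_field_def
    by (rule Q2_adjoin_eq_adjoin_root[OF t n, of E m]) (use roots in \<open>auto simp: two_torsion T_def\<close>)
  have plus: "Q2_adjoin {T (to_ac m + to_ac n * t)} = adjoin_root t"
    by (rule Q2_adjoin_eq_adjoin_root[OF t n, of E m]) (use roots in \<open>auto simp: T_def\<close>)
  have minus: "Q2_adjoin {T (to_ac m - to_ac n * t)} = adjoin_root t"
    by (rule Q2_adjoin_eq_adjoin_root[OF t, of "- n" E m]) (use n roots in \<open>auto simp: T_def\<close>)
  have rational: "Q2_adjoin {Origin} = Q2" "Q2_adjoin {T (to_ac e)} = Q2"
    unfolding T_def by (rule Q2_adjoin_Origin Q2_adjoin_rational_point)+
  show ?thesis
  proof (cases "t \<in> Q2")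
    \<comment> \<open>The field is \<open>Q2\<close>, to which none of the other three is
      isomorphic, so the second claim holds vacuously.\<close>
    case True
    then have "two_division_field E = Q2"
      unfolding F using adjoin_root_subset[OF subfield_Q2] Q2_subset_adjoin_root by blast
    moreover have "\<not> isomorphic_to_L1 Q2" "\<not> isomorphic_to_L2 Q2"
      unfolding isomorphic_to_L1_def isomorphic_to_L2_def by (simp_all add: not_Q2_isomorphic_quotient_ring)
    ultimately show ?thesis
      using isomorphic_to_Q2_Q2 not_isomorphic_to_Q4_Q2 by (simp add: Let_def)
  next
    case False
    have "c \<noteq> 1"
    proof
      assume "c = 1"
      then have "t = to_ac 1 \<or> t = to_ac (- 1)"
        using t by (simp add: power2_eq_1_iff)
      then show False
        using False by blast
    qed
    then consider "c = 5" | "c = -1" | "c = -5"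
      using c by blast
    \<comment> \<open>The constant term 1 - d in \<open>Q2_isomorphic_quotient_ring\<close> is 2 for
      d = -1 and 6 for d = -5, as in L1 and L2.\<close>
    then have "isomorphic_to_Q4 (adjoin_root t) \<or> isomorphic_to_L1 (adjoin_root t) \<or> isomorphic_to_L2 (adjoin_root t)"
    proof cases
      case 1
      then show ?thesis
        using isomorphic_to_Q4_adjoin_sqrt5 t by simp
    next
      case 2
      then show ?thesis
        using Q2_isomorphic_quotient_ring[OF t False] by (simp add: isomorphic_to_L1_def)
    next
      case 3
      then show ?thesis
        using Q2_isomorphic_quotient_ring[OF t False] by (simp add: isomorphic_to_L2_def)
    qed
    moreover have ne: "adjoin_root t \<noteq> Q2"
      using False adjoin_root_self by blast
    have "to_ac n * t \<noteq> - (to_ac n * t)"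
      using n c0 t by auto
    then have "to_ac m + to_ac n * t \<noteq> to_ac m - to_ac n * t"
      by simp
    moreover have "{P \<in> two_torsion E. Q2_adjoin {P} = Q2} = {Origin, T (to_ac e)}"
      using ne by (auto simp: two_torsion plus minus rational)
    moreover have "{P \<in> two_torsion E. Q2_adjoin {P} \<noteq> Q2} =
        {T (to_ac m + to_ac n * t), T (to_ac m - to_ac n * t)}"
      using ne by (auto simp: two_torsion plus minus rational)
    moreover have "\<forall>P \<in> two_torsion E. Q2_adjoin {P} \<noteq> Q2 \<longrightarrow> Q2_adjoin {P} = adjoin_root t"
      by (auto simp: two_torsion plus minus rational)
    ultimately show ?thesis
      unfolding F Let_def using T_Origin by (simp add: T_eq card_insert_if)
  qed
qed

end
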